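(* Let $M$ be a matroid of rank $r$ on a nonempty finite set $E$ with $n$ elements. Then $$\omega^\circ(M)=\sum_{S_\bullet}(-1)^{k-1}\,\#\{\text{Ferroni paths weakly above all } p_M(S_1),\dots,p_M(S_{k-1})\},$$ the sum over all chains $\emptyset=S_0\subsetneq S_1\subsetneq\dots\subsetneq S_k=E$ ($k\ge 1$) of subsets of $E$ all of whose members $S_0,\dots,S_k$ are crowding records. (In particular the sum is empty if $E$ is not a crowding record.)
   Context: **Crowding.** For $S\subseteq E$, $\operatorname{crowd}(S)=|S|-2\operatorname{rank}_M(S)$. For $T\subseteq S\subseteq E$, $T$ is a summand of $S$ if $\operatorname{rank}_M(S)=\operatorname{rank}_M(T)+\operatorname{rank}_M(S\setminus T)$. $T$ is overcrowded in $S$ if either $\operatorname{crowd}(T)>\operatorname{crowd}(S)$, or $\operatorname{crowd}(T)=\operatorname{crowd}(S)$ and $T$ is not a summand of $S$. $S$ is a crowding record if no subset of $S$ is overcrowded in $S$. **Ferroni paths.** For $S\subseteq E$, $p_M(S)=(|S|-\operatorname{rank}_M(S),\operatorname{rank}_M(S))\in\mathbb Z^2$. A Ferroni path here is a lattice path from $(\tfrac12,\tfrac12)$ to $(n-r-\tfrac12,r-\tfrac12)$ with steps $(1,1)$ or $(1,0)$; thus a sequence of $n-r-1$ steps of which exactly $r-1$ are $(1,1)$ (there are none if this is impossible). It lies weakly above an integer point $(a,b)$ if it does not pass strictly below it (passing through is allowed); explicitly, if at least $b$ of its first $\min(a,n-r-1)$ steps are $(1,1)$. **$g$ and $\omega$.**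 Let $c(M)$ be the number of connected components of $M$. Speyer's $g$-polynomial $g_M(t)\in\mathbb Z[t]$ is given as follows (in the form of Berget–Eur–Spink–Tseng, equivalent to the original $K$-theoretic definition). If $E=\emptyset$, $g_M=1$. If $M$ has a loop or a coloop, $g_M=0$. Otherwise, for each total ordering $w=(w_1,\dots,w_n)$ of $E$, let $B_w$ be the basis with $w_k\in B_w$ iff $\operatorname{rank}\{w_1,\dots,w_k\}>\operatorname{rank}\{w_1,\dots,w_{k-1}\}$. In $\mathbb Z[z_e:e\in E]$, let $x^w$ be the list of the $z_b$, $b\in B_w$; let $y^w$ be the list of the $-z_c$, $c\in E\setminus B_w$; let $\alpha^w=-z_{w_n}$. For a family $f=(f_w)_w$ put $\deg f=\sum_w f_w/\prod_{i=1}^{n-1}(z_{w_i}-z_{w_{i+1}})$. With $\boldsymbol e_k$ the $k$-th elementary symmetric polynomial, $$g_M(t)=(-1)^{c(M)}\sum_{i=1}^{r}(-t)^i\sum_{j=0}^{i-1}\deg\big(\alpha^j\,\boldsymbol e_{i-j-1}(-y)\,\boldsymbol e_{r-i}(x)\,\boldsymbol e_{n-r}(y)\big).$$ $\omega(M)$ is the coefficient of $t^r$ in $g_M(t)$, and $\omega^\circ(M)=(-1)^{c(M)-1}\omega(M)$. *)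

theory Defs
  imports
    "HOL-Library.Poly_Mapping"
    "HOL-Library.Countable_Set"
    "HOL-Computational_Algebra.Polynomial"
    "HOL-Computational_Algebra.Fraction_Field"
    "HOL-Combinatorics.Multiset_Permutations"
begin

section \<open>Matroids\<close>

locale matroid =
  fixes E :: "'a set" and indep :: "'a set \<Rightarrow> bool"
  assumes finite_ground: "finite E"
    and indep_ground: "indep X \<Longrightarrow> X \<subseteq> E"
    and indep_empty: "indep {}"
    and indep_subset: "indep X \<Longrightarrow> Y \<subseteq> X \<Longrightarrow> indep Y"
    and indep_augment:
      "indep X \<Longrightarrow> indep Y \<Longrightarrow> card X < card Y \<Longrightarrow> \<exists>e\<in>Y - X. indep (insert e X)"
begin

definition rank :: "'a set \<Rightarrow> nat" where
  "rank S = Max (card ` {X. X \<subseteq> S \<and> indep X})"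

definition basis :: "'a set \<Rightarrow> bool" where
  "basis B \<longleftrightarrow> indep B \<and> (\<forall>X. indep X \<longrightarrow> B \<subseteq> X \<longrightarrow> X = B)"

definition circuit :: "'a set \<Rightarrow> bool" where
  "circuit C \<longleftrightarrow> C \<subseteq> E \<and> \<not> indep C \<and> (\<forall>e\<in>C. indep (C - {e}))"

definition loop :: "'a \<Rightarrow> bool" where
  "loop e \<longleftrightarrow> e \<in> E \<and> \<not> indep {e}"

definition coloop :: "'a \<Rightarrow> bool" where
  "coloop e \<longleftrightarrow> e \<in> E \<and> (\<forall>B. basis B \<longrightarrow> e \<in> B)"

definition components :: "'a set set" where
  "components =
     E // {(e, f). e \<in> E \<and> f \<in> E \<and> (e = f \<or> (\<exists>C. circuit C \<and> e \<in> C \<and> f \<in> C))}"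

end

section \<open>Crowding\<close>

context matroid
begin

definition crowd :: "'a set \<Rightarrow> int" where
  "crowd S = int (card S) - 2 * int (rank S)"

definition summand :: "'a set \<Rightarrow> 'a set \<Rightarrow> bool" where
  "summand T S \<longleftrightarrow> T \<subseteq> S \<and> rank S = rank T + rank (S - T)"

definition overcrowded :: "'a set \<Rightarrow> 'a set \<Rightarrow> bool" where
  "overcrowded T S \<longleftrightarrow>
     T \<subseteq> S \<and> (crowd T > crowd S \<or> (crowd T = crowd S \<and> \<not> summand T S))"

definition crowding_record :: "'a set \<Rightarrow> bool" where
  "crowding_record S \<longleftrightarrow> S \<subseteq> E \<and> \<not> (\<exists>T\<subseteq>S. overcrowded T S)"

definition record_chains :: "'a set list set" where
  "record_chains = {Ss. 2 \<le> length Ss \<and> hd Ss = {} \<and> last Ss = E \<and>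
     sorted_wrt (\<subset>) Ss \<and> (\<forall>S\<in>set Ss. crowding_record S)}"

text \<open>The sum over \<open>record_chains\<close> is a genuine finite sum.\<close>

lemma finite_record_chains: "finite record_chains"
proof (rule finite_subset)
  show "record_chains \<subseteq> {Ss. set Ss \<subseteq> Pow E \<and> distinct Ss}"
  proof
    fix Ss assume Ss: "Ss \<in> record_chains"
    have "distinct Ss"
      using Ss by (auto simp: record_chains_def sorted_wrt_iff_nth_less distinct_conv_nth)
        (metis linorder_neqE_nat psubset_eq)
    moreover have "set Ss \<subseteq> Pow E"
      using Ss by (auto simp: record_chains_def crowding_record_def)
    ultimately show "Ss \<in> {Ss. set Ss \<subseteq> Pow E \<and> distinct Ss}" by simp
  qed
  show "finite {Ss. set Ss \<subseteq> Pow E \<and> distinct Ss}"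
    by (rule finite_subset_distinct) (simp add: finite_ground)
qed

end

section \<open>Ferroni paths\<close>

text \<open>
  A path is given by its list of steps, \<^const>\<open>True\<close> standing for the step (1,1) and
  \<^const>\<open>False\<close> for the step (1,0).
\<close>

context matroid
begin

text \<open>
  The numbers of steps, \<open>n - r - 1\<close> in total and \<open>r - 1\<close> of them (1,1), are written
  without subtraction, so that there is no path when one of them is negative.
\<close>

definition ferroni_paths :: "bool list set" where
  "ferroni_paths =
     {P. length P + rank E + 1 = card E \<and> count_list P True + 1 = rank E}"

text \<open>The subtraction is harmless, since the rank of a subset of \<open>E\<close> is at most its size.\<close>

definition lattice_point :: "'a set \<Rightarrow> nat \<times> nat" where
  "lattice_point S = (card S - rank S, rank S)"

end

definition weakly_above :: "bool list \<Rightarrow> nat \<times> nat \<Rightarrow> bool" where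
  "weakly_above P p = (case p of (a, b) \<Rightarrow> b \<le> count_list (take (min a (length P)) P) True)"

section \<open>Speyer's g-polynomial and omega\<close>

text \<open>
  The fraction field of the integer polynomial ring in variables indexed by natural numbers.
  The ring of polynomials in the \<open>z e\<close>, \<open>e \<in> E\<close>, is embedded into it by numbering the
  elements of the finite set \<open>E\<close>; this avoids a linear order on \<open>'a\<close>, which the integral
  domain instance for polynomials would otherwise require.
\<close>

type_synonym zfrac = "((nat \<Rightarrow>\<^sub>0 nat) \<Rightarrow>\<^sub>0 int) fract"

definition zvar :: "'a set \<Rightarrow> 'a \<Rightarrow> zfrac" where
  "zvar E e = Fract (Poly_Mapping.single (Poly_Mapping.single (to_nat_on E e) 1) 1) 1"

text \<open>The \<open>k\<close>-th elementary symmetric polynomial of the family \<open>(f a)\<close>, \<open>a \<in> A\<close>.\<close>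

definition elem_sym :: "nat \<Rightarrow> ('a \<Rightarrow> 'b::comm_ring_1) \<Rightarrow> 'a set \<Rightarrow> 'b" where
  "elem_sym k f A = (\<Sum>X | X \<subseteq> A \<and> card X = k. \<Prod>a\<in>X. f a)"

context matroid
begin

text \<open>A total ordering of \<open>E\<close> is a list enumerating \<open>E\<close> without repetition (indexed from 0).\<close>

definition order_basis :: "'a list \<Rightarrow> 'a set" where
  "order_basis w =
     {w ! k | k. k < length w \<and> rank (set (take (Suc k) w)) > rank (set (take k w))}"

definition deg :: "('a list \<Rightarrow> zfrac) \<Rightarrow> zfrac" where
  "deg f = (\<Sum>w\<in>permutations_of_set E.
     f w / (\<Prod>i<card E - 1. zvar E (w ! i) - zvar E (w ! Suc i)))"

definition xvar :: "'a \<Rightarrow> zfrac" where "xvar b = zvar E b"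

definition yvar :: "'a \<Rightarrow> zfrac" where "yvar c = - zvar E c"

definition alpha :: "'a list \<Rightarrow> zfrac" where "alpha w = - zvar E (last w)"

text \<open>
  The values of \<open>deg\<close> occurring here are in fact integer constants; the polynomial is
  stated over the fraction field in which its defining formula lives.
\<close>

definition g_poly :: "zfrac poly" where
  "g_poly =
     (if E = {} then 1
      else if \<exists>e. loop e \<or> coloop e then 0
      else (-1) ^ card components *
        (\<Sum>i=1..rank E. smult
           (\<Sum>j<i. deg (\<lambda>w.
              alpha w ^ j
              * elem_sym (i - j - 1) (\<lambda>c. - yvar c) (E - order_basis w)
              * elem_sym (rank E - i) xvar (order_basis w)
              * elem_sym (card E - rank E) yvar (E - order_basis w)))
           ((- [:0, 1:]) ^ i)))"

definition omega :: zfrac where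
  "omega = coeff g_poly (rank E)"

text \<open>
  For \<open>E \<noteq> {}\<close> there is at least one component, so the truncated subtraction is the true one.
\<close>

definition omega_circ :: zfrac where
  "omega_circ = (-1) ^ (card components - 1) * omega"

end

end

theory Submission
  imports Defs
begin

text \<open>
  For \<open>E\<close> without loops and coloops, the last element \<open>l\<close> of an ordering \<open>w\<close> never lies in \<open>B\<^sub>w\<close>, and
  the alternating sum over \<open>j\<close> removes \<open>z\<^sub>l\<close> from the elementary symmetric polynomial. Expanding
  what remains over Ferroni paths \<open>P\<close>, the numerator for \<open>w\<close> is the monomial in which \<open>w\<^sub>i\<close> has exponent
  \<open>\<delta>(S\<^sub>i) - \<delta>(S\<^sub>i\<^sub>-\<^sub>1)\<close>, where \<open>S\<^sub>i = {w\<^sub>1, \<dots>, w\<^sub>i}\<close> and \<open>\<delta>(S)\<close> is the nullity \<open>a\<close> of \<open>S\<close> plus the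
  number of diagonal steps among the first \<open>a\<close> steps of \<open>P\<close>.

  For any monotone \<open>\<delta>\<close>, lowering \<open>\<delta>\<close> by one at a single set \<open>U\<close> changes the sum of
  these monomials over \<open>\<Prod>(z\<^bsub>w\<^sub>i\<^esub> - z\<^bsub>w\<^sub>i\<^sub>+\<^sub>1\<^esub>)\<close> by a product of two sums of the same kind, for the orderings
  of \<open>U\<close> and of its complement. Induction down to Lagrange interpolation shows that the sum vanishes
  in too small degree and otherwise is, up to sign, the Moebius number of the poset of sets with
  \<open>\<delta>(S) \<ge> |S|\<close>, which says that \<open>P\<close> is weakly above \<open>p\<^sub>M(S)\<close>.

  Finally, a nonrecord \<open>S\<close> in that poset has Moebius number zero: supermodularity of the
  crowd makes \<open>U \<mapsto> U \<inter> T\<close> act on the poset below \<open>S\<close>, for a largest overcrowded \<open>T\<close> of maximal crowd.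
  So only chains of records contribute.
\<close>

section \<open>Sums over orderings\<close>

lemma sum_permutations_of_set_snoc:
  assumes "finite S" "S \<noteq> {}"
  shows "(\<Sum>w\<in>permutations_of_set S. f w) =
    (\<Sum>a\<in>S. \<Sum>w\<in>permutations_of_set (S - {a}). f (w @ [a]))"
proof -
  let ?P = "Sigma S (\<lambda>a. permutations_of_set (S - {a}))"
  let ?g = "\<lambda>(a, w). w @ [a]"
  have "inj_on ?g ?P" by (auto simp: inj_on_def)
  moreover have "?g ` ?P = permutations_of_set S"
  proof
    show "?g ` ?P \<subseteq> permutations_of_set S"
      by (clarsimp simp: permutations_of_set_def) blast
    show "permutations_of_set S \<subseteq> ?g ` ?P"
    proof
      fix w assume w: "w \<in> permutations_of_set S"
      then have "w \<noteq> []" using assms by (auto simp: permutations_of_set_def)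
      then obtain v a where "w = v @ [a]" by (metis append_butlast_last_id)
      with w show "w \<in> ?g ` ?P"
        by (intro image_eqI[of _ _ "(a, v)"]) (auto simp: permutations_of_set_def)
    qed
  qed
  ultimately have "(\<Sum>w\<in>permutations_of_set S. f w) = (\<Sum>p\<in>?P. f (?g p))"
    by (metis (no_types, lifting) sum.reindex_cong)
  also have "\<dots> = (\<Sum>a\<in>S. \<Sum>w\<in>permutations_of_set (S - {a}). f (w @ [a]))"
    using assms by (subst sum.Sigma) (auto intro!: sum.cong)
  finally show ?thesis .
qed

text \<open>Isolates the orderings whose flag passes through \<open>U\<close>: each is an ordering
  of \<open>U\<close> followed by one of its complement.\<close>

lemma sum_permutations_of_set_prefix:
  assumes "finite S" "U \<subseteq> S"
  shows "(\<Sum>w | w \<in> permutations_of_set S \<and> set (take (card U) w) = U. f w) =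
    (\<Sum>u\<in>permutations_of_set U. \<Sum>v\<in>permutations_of_set (S - U). f (u @ v))"
proof -
  let ?P = "permutations_of_set U \<times> permutations_of_set (S - U)"
  let ?g = "\<lambda>(u, v). u @ v"
  let ?W = "{w \<in> permutations_of_set S. set (take (card U) w) = U}"
  have inj: "inj_on ?g ?P"
    by (auto simp: inj_on_def dest!: length_finite_permutations_of_set)
  have len: "length u = card U" if "u \<in> permutations_of_set U" for u
    using that by (rule length_finite_permutations_of_set)
  have im: "?g ` ?P = ?W"
  proof
    show "?g ` ?P \<subseteq> ?W"
      using assms len by (auto simp: permutations_of_set_def)
    show "?W \<subseteq> ?g ` ?P"
    proof
      fix w assume w: "w \<in> ?W"
      then have d: "distinct w" and s: "set w = S" and U: "set (take (card U) w) = U"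
        by (auto simp: permutations_of_set_def)
      have "distinct (take (card U) w @ drop (card U) w)" using d by simp
      then have "set (take (card U) w) \<inter> set (drop (card U) w) = {}"
        by (simp only: distinct_append)
      moreover have "set (take (card U) w) \<union> set (drop (card U) w) = S"
        using s by (metis append_take_drop_id set_append)
      ultimately have "set (drop (card U) w) = S - U" using U by blast
      then show "w \<in> ?g ` ?P" using d U
        by (intro image_eqI[of _ _ "(take (card U) w, drop (card U) w)"])
          (auto simp: permutations_of_set_def)
    qed
  qed
  have "(\<Sum>w\<in>?W. f w) = (\<Sum>p\<in>?P. f (?g p))"
    using inj im by (metis (no_types, lifting) sum.reindex_cong)
  also have "\<dots> = (\<Sum>u\<in>permutations_of_set U. \<Sum>v\<in>permutations_of_set (S - U). f (u @ v))"
    by (simp add: sum.cartesian_product split_def)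
  finally show ?thesis .
qed

section \<open>Lagrange interpolation: divided differences of powers, up to sign\<close>

definition lagrange_sum :: "('a \<Rightarrow> 'k::field) \<Rightarrow> 'a set \<Rightarrow> nat \<Rightarrow> 'k" where
  "lagrange_sum z S D = (\<Sum>a\<in>S. z a ^ D / (\<Prod>b\<in>S - {a}. z b - z a))"

text \<open>The factor \<open>z q - z a\<close> kills the term at \<open>q\<close> and cancels one
  factor of every other denominator. This is the recursion of divided differences.\<close>

lemma lagrange_sum_remove:
  assumes "finite S" "q \<in> S" "inj_on z S"
  shows "z q * lagrange_sum z S D - lagrange_sum z S (Suc D) = lagrange_sum z (S - {q}) D"
proof -
  have "z q * lagrange_sum z S D - lagrange_sum z S (Suc D) =
      (\<Sum>a\<in>S. z a ^ D * (z q - z a) / (\<Prod>b\<in>S - {a}. z b - z a))"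
    by (simp add: lagrange_sum_def sum_distrib_left sum_subtractf[symmetric]
        diff_divide_distrib[symmetric] algebra_simps)
  also have "\<dots> = (\<Sum>a\<in>S - {q}. z a ^ D * (z q - z a) / (\<Prod>b\<in>S - {a}. z b - z a))"
    using assms by (subst sum.remove[of _ q]) auto
  also have "\<dots> = (\<Sum>a\<in>S - {q}. z a ^ D / (\<Prod>b\<in>S - {q} - {a}. z b - z a))"
  proof (rule sum.cong)
    fix a assume a: "a \<in> S - {q}"
    then have "(\<Prod>b\<in>S - {a}. z b - z a) = (z q - z a) * (\<Prod>b\<in>S - {q} - {a}. z b - z a)"
      using assms by (subst prod.remove[of _ q]) (auto intro!: prod.cong)
    moreover have "z q - z a \<noteq> 0" using a assms by (auto dest: inj_onD)
    ultimately show "z a ^ D * (z q - z a) / (\<Prod>b\<in>S - {a}. z b - z a) =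
        z a ^ D / (\<Prod>b\<in>S - {q} - {a}. z b - z a)" by simp
  qed simp
  finally show ?thesis by (simp add: lagrange_sum_def)
qed

text \<open>Below the top degree, two instances of the recursion are subtracted. In the top degree
  one instance suffices, because the sum of one degree less already vanishes; it contributes the
  sign.\<close>

lemma lagrange_sum_eq:
  assumes "finite S" "inj_on z S" "D < card S"
  shows "lagrange_sum z S D = (if Suc D = card S then (-1) ^ D else 0)"
  using assms
proof (induction "card S" arbitrary: S D rule: less_induct)
  case less
  then have "S \<noteq> {}" by auto
  then obtain q where q: "q \<in> S" by auto
  have IH: "lagrange_sum z (S - {x}) D' = (if Suc D' = card S - 1 then (-1) ^ D' else 0)"
    if "x \<in> S" "D' < card S - 1" for x D'
    using less.hyps[of "S - {x}" D'] less.prems that inj_on_subset[of z S "S - {x}"]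
    by (auto simp: card_Diff_singleton)
  have zero: "lagrange_sum z S D' = 0" if D': "Suc D' < card S" for D'
  proof -
    have "card (S - {q}) > 0" using D' q less.prems by (simp add: card_Diff_singleton)
    then have "S - {q} \<noteq> {}" by (metis card.empty less_irrefl)
    then obtain p where p: "p \<in> S" "p \<noteq> q" by blast
    have "(z q - z p) * lagrange_sum z S D' = lagrange_sum z (S - {q}) D' - lagrange_sum z (S - {p}) D'"
      using lagrange_sum_remove[of S q z D'] lagrange_sum_remove[of S p z D'] p q less.prems
      by (simp add: algebra_simps)
    \<comment> \<open>By induction both terms have the same value, which depends only on
      \<open>D'\<close> and the cardinality.\<close>
    also have "\<dots> = 0" using IH[of q D'] IH[of p D'] p q D' by simp
    finally show ?thesis using p q less.prems by (auto dest: inj_onD)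
  qed
  show ?case
  proof (cases "Suc D < card S")
    case True
    then show ?thesis using zero by simp
  next
    case False
    then have D: "card S = Suc D" using less.prems by simp
    show ?thesis
    proof (cases D)
      case 0
      then obtain a where "S = {a}" using D by (auto simp: card_1_singleton_iff)
      then show ?thesis using 0 by (simp add: lagrange_sum_def)
    next
      case (Suc D')
      then have "z q * 0 - lagrange_sum z S (Suc D') = lagrange_sum z (S - {q}) D'"
        using lagrange_sum_remove[of S q z D'] zero[of D'] D q less.prems by simp
      then have "lagrange_sum z S (Suc D') = - lagrange_sum z (S - {q}) D'"
        by (metis diff_0 minus_minus mult_zero_right)
      then show ?thesis using IH[of q D'] q D Suc by simp
    qed
  qed
qed

section \<open>Reciprocals of the denominators of \<open>deg\<close>, summed over orderings\<close>

fun path_weight :: "('a \<Rightarrow> 'k::field) \<Rightarrow> 'a list \<Rightarrow> 'k" where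
  "path_weight z [] = 1"
| "path_weight z [a] = 1"
| "path_weight z (a # b # w) = path_weight z (b # w) / (z a - z b)"

lemma path_weight_append:
  assumes "u \<noteq> []" "v \<noteq> []"
  shows "path_weight z (u @ v) = path_weight z u * path_weight z v / (z (last u) - z (hd v))"
  using assms
proof (induction z u rule: path_weight.induct)
  case (2 z a)
  then show ?case by (cases v) auto
qed auto

lemma path_weight_eq_prod:
  "path_weight z w = 1 / (\<Prod>i<length w - 1. z (w ! i) - z (w ! Suc i))"
proof (induction z w rule: path_weight.induct)
  case (3 z a b w)
  have "(\<Prod>i<length (a # b # w) - 1. z ((a # b # w) ! i) - z ((a # b # w) ! Suc i)) =
      (z a - z b) * (\<Prod>i<length (b # w) - 1. z ((b # w) ! i) - z ((b # w) ! Suc i))"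
    by (simp add: prod.lessThan_Suc_shift del: prod.lessThan_Suc)
  then show ?case using 3 by simp
qed auto

text \<open>Induction by splitting off the last but one element \<open>b\<close>. The terms obtained
  are the negatives of those of \<open>lagrange_sum z S 0\<close> at the points other than
  \<open>a\<close>. That sum vanishes once \<open>S\<close> has two elements, so the term at
  \<open>a\<close> is what remains.\<close>

lemma sum_path_weight_last:
  assumes "finite S" "inj_on z S" "a \<in> S"
  shows "(\<Sum>w\<in>permutations_of_set (S - {a}). path_weight z (w @ [a])) =
    1 / (\<Prod>b\<in>S - {a}. z b - z a)"
  using assms
proof (induction "card S" arbitrary: S a rule: less_induct)
  case less
  show ?case
  proof (cases "S - {a} = {}")
    case True
    then show ?thesis by (simp only: permutations_of_set_empty) simp
  next
    case False
    have fin: "finite (S - {a})" using less.prems by simp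
    have c2: "Suc 0 < card S"
      using False less.prems card_gt_0_iff[of "S - {a}"] by (simp add: card_Diff_singleton)
    have "(\<Sum>w\<in>permutations_of_set (S - {a}). path_weight z (w @ [a])) =
       (\<Sum>b\<in>S - {a}. \<Sum>w\<in>permutations_of_set (S - {a} - {b}). path_weight z ((w @ [b]) @ [a]))"
      by (rule sum_permutations_of_set_snoc[OF fin False])
    also have "\<dots> = (\<Sum>b\<in>S - {a}. (\<Sum>w\<in>permutations_of_set (S - {a} - {b}). path_weight z (w @ [b])) / (z b - z a))"
      by (subst path_weight_append) (simp_all add: sum_divide_distrib)
    also have "\<dots> = (\<Sum>b\<in>S - {a}. - (1 / (\<Prod>c\<in>S - {b}. z c - z b)))"
    proof (rule sum.cong)
      fix b assume b: "b \<in> S - {a}"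
      have "(\<Sum>w\<in>permutations_of_set (S - {a} - {b}). path_weight z (w @ [b])) =
          1 / (\<Prod>c\<in>S - {a} - {b}. z c - z b)"
        using less.hyps[of "S - {a}" b] less.prems b c2 inj_on_subset[of z S "S - {a}"]
        by (auto simp: card_Diff_singleton)
      moreover have "(\<Prod>c\<in>S - {b}. z c - z b) = (z a - z b) * (\<Prod>c\<in>S - {a} - {b}. z c - z b)"
        using b less.prems by (subst prod.remove[of _ a]) (auto intro!: prod.cong)
      ultimately show "(\<Sum>w\<in>permutations_of_set (S - {a} - {b}). path_weight z (w @ [b])) / (z b - z a)
          = - (1 / (\<Prod>c\<in>S - {b}. z c - z b))"
        by (metis (no_types, lifting) divide_divide_eq_left minus_diff_eq mult.commute
            mult_minus_right divide_minus_right)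
    qed simp
    also have "\<dots> = 1 / (\<Prod>b\<in>S - {a}. z b - z a) - lagrange_sum z S 0"
      using less.prems by (simp add: lagrange_sum_def sum_negf sum.remove[of _ a])
    also have "lagrange_sum z S 0 = 0"
      using lagrange_sum_eq[of S z 0] c2 less.prems by simp
    finally show ?thesis by simp
  qed
qed

text \<open>Grouping by the last element gives a Lagrange sum. This is the base case for the flag
  sums below.\<close>

lemma sum_power_last_path_weight:
  assumes "finite S" "inj_on z S" "D < card S"
  shows "(\<Sum>w\<in>permutations_of_set S. z (last w) ^ D * path_weight z w) =
    (if Suc D = card S then (-1) ^ D else 0)"
proof -
  have "S \<noteq> {}" using assms by auto
  then have "(\<Sum>w\<in>permutations_of_set S. z (last w) ^ D * path_weight z w) =
     (\<Sum>a\<in>S. z a ^ D * (\<Sum>w\<in>permutations_of_set (S - {a}). path_weight z (w @ [a])))"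
    using assms by (simp add: sum_permutations_of_set_snoc sum_distrib_left)
  also have "\<dots> = lagrange_sum z S D"
    using assms by (simp add: sum_path_weight_last lagrange_sum_def)
  finally show ?thesis using lagrange_sum_eq[OF assms] by simp
qed

section \<open>Moebius numbers of families of sets\<close>

text \<open>The Moebius function of the poset \<open>X\<close> with \<open>A\<close> and
  \<open>B\<close> adjoined: neither end has to belong to \<open>X\<close>, whence the clause
  \<open>C = A\<close>. The guard \<open>finite B\<close> makes the recursion terminate by
  cardinality.\<close>

function mobius :: "'a set set \<Rightarrow> 'a set \<Rightarrow> 'a set \<Rightarrow> int" where
  "mobius X A B =
     (if A = B then 1
      else if finite B \<and> A \<subset> B
        then - (\<Sum>C | A \<subseteq> C \<and> C \<subset> B \<and> (C = A \<or> C \<in> X). mobius X A C)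
      else 0)"
  by auto
termination
  by (relation "measure (\<lambda>(X, A, B). card B)") (auto intro: psubset_card_mono)

declare mobius.simps[simp del]

lemma mobius_self [simp]: "mobius X A A = 1"
  by (simp add: mobius.simps)

lemma mobius_psubset:
  assumes "finite B" "A \<subset> B"
  shows "mobius X A B = - (\<Sum>C | A \<subseteq> C \<and> C \<subset> B \<and> (C = A \<or> C \<in> X). mobius X A C)"
  using assms by (subst mobius.simps) auto

lemma mobius_cong:
  assumes "finite B" "\<And>C. A \<subset> C \<Longrightarrow> C \<subset> B \<Longrightarrow> C \<in> X \<longleftrightarrow> C \<in> Y"
  shows "mobius X A B = mobius Y A B"
  using assms
proof (induction "card B" arbitrary: B rule: less_induct)
  case less
  show ?case
  proof (cases "A \<subset> B")
    case True
    have "mobius X A C = mobius Y A C" if "C \<subset> B" for C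
    proof (rule less.hyps)
      show "card C < card B" "finite C"
        using that less.prems by (auto intro: psubset_card_mono finite_subset)
      show "D \<in> X \<longleftrightarrow> D \<in> Y" if "A \<subset> D" "D \<subset> C" for D
        using less.prems(2)[of D] that \<open>C \<subset> B\<close> by blast
    qed
    moreover have "{C. A \<subseteq> C \<and> C \<subset> B \<and> (C = A \<or> C \<in> X)} =
        {C. A \<subseteq> C \<and> C \<subset> B \<and> (C = A \<or> C \<in> Y)}"
      using less.prems(2) by blast
    ultimately have "(\<Sum>C | A \<subseteq> C \<and> C \<subset> B \<and> (C = A \<or> C \<in> X). mobius X A C) =
       (\<Sum>C | A \<subseteq> C \<and> C \<subset> B \<and> (C = A \<or> C \<in> Y). mobius Y A C)"
      by (metis (no_types, lifting) mem_Collect_eq sum.cong)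
    then show ?thesis using less True by (simp add: mobius_psubset)
  next
    case False
    then show ?thesis by (simp add: mobius.simps[of _ A B])
  qed
qed

text \<open>In terms of signed chains, those passing through \<open>U\<close> factor into a part
  below and a part above \<open>U\<close>, and the others avoid \<open>U\<close>. The proof derives
  this from the recursion, by induction on the size of \<open>B\<close>.\<close>

lemma mobius_split:
  assumes "finite B" "A \<subset> U" "U \<subset> B" "U \<in> X"
  shows "mobius X A B = mobius (X - {U}) A B + mobius X A U * mobius X U B"
  using assms
proof (induction "card B" arbitrary: B rule: less_induct)
  case less
  let ?I = "{C. A \<subseteq> C \<and> C \<subset> B \<and> (C = A \<or> C \<in> X)}"
  let ?J = "{C. U \<subseteq> C \<and> C \<subset> B \<and> (C = U \<or> C \<in> X)}"
  have fin: "finite ?I" "finite ?J"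
    using less.prems by (auto intro: finite_subset[of _ "Pow B"])
  have AB: "A \<subset> B" using less.prems by auto
  have eq: "mobius X A C = mobius (X - {U}) A C + (if U \<subset> C then mobius X A U * mobius X U C else 0)"
    if "C \<subset> B" for C
  proof (cases "U \<subset> C")
    case True
    then show ?thesis using less that by (auto intro: psubset_card_mono finite_subset)
  next
    case False
    have "mobius X A C = mobius (X - {U}) A C"
      using that less.prems False by (intro mobius_cong) (auto intro: finite_subset)
    then show ?thesis using False by simp
  qed
  have "(\<Sum>C\<in>?I. mobius X A C) = (\<Sum>C\<in>?I - {U}. mobius X A C) + mobius X A U"
    using less.prems fin by (subst sum.remove[of _ U]) auto
  also have "(\<Sum>C\<in>?I - {U}. mobius X A C) =
     (\<Sum>C\<in>?I - {U}. mobius (X - {U}) A C) +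
     (\<Sum>C\<in>?I - {U}. if U \<subset> C then mobius X A U * mobius X U C else 0)"
    by (subst sum.distrib[symmetric]) (auto intro!: sum.cong eq)
  also have "(\<Sum>C\<in>?I - {U}. mobius (X - {U}) A C) = - mobius (X - {U}) A B"
    using less.prems AB by (subst mobius_psubset) (auto intro!: sum.cong)
  also have "(\<Sum>C\<in>?I - {U}. if U \<subset> C then mobius X A U * mobius X U C else 0) =
      (\<Sum>C\<in>?J - {U}. mobius X A U * mobius X U C)"
    using fin less.prems by (subst sum.inter_filter[symmetric]) (auto intro!: sum.cong)
  \<comment> \<open>The subtracted 1 is the term at \<open>C = U\<close>; it cancels against the
    summand \<open>mobius X A U\<close> split off at the start.\<close>
  also have "\<dots> = mobius X A U * ((\<Sum>C\<in>?J. mobius X U C) - 1)"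
  proof -
    have "(\<Sum>C\<in>?J. mobius X U C) = 1 + (\<Sum>C\<in>?J - {U}. mobius X U C)"
      using fin less.prems by (subst sum.remove[of _ U]) auto
    then show ?thesis by (simp add: sum_distrib_left)
  qed
  also have "(\<Sum>C\<in>?J. mobius X U C) = - mobius X U B"
    using less.prems by (subst mobius_psubset) auto
  finally show ?case
    using mobius_psubset[OF less.prems(1) AB, of X] by (simp add: algebra_simps)
qed

lemma sum_mobius_below:
  assumes "finite V" "A \<subset> V" "V \<in> X"
  shows "(\<Sum>C | A \<subseteq> C \<and> C \<subseteq> V \<and> (C = A \<or> C \<in> X). mobius X A C) = 0"
proof -
  let ?I = "{C. A \<subseteq> C \<and> C \<subset> V \<and> (C = A \<or> C \<in> X)}"
  have "{C. A \<subseteq> C \<and> C \<subseteq> V \<and> (C = A \<or> C \<in> X)} = insert V ?I"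
    using assms by auto
  moreover have "finite ?I" using assms(1) by (auto intro: finite_subset[of _ "Pow V"])
  ultimately show ?thesis using mobius_psubset[OF assms(1,2), of X] by simp
qed

text \<open>A set with Moebius number zero contributes nothing to the recursion of any larger set,
  so it may be deleted from the poset.\<close>

lemma mobius_Int:
  assumes "finite B" and "\<And>U. A \<subset> U \<Longrightarrow> U \<subset> B \<Longrightarrow> U \<in> X \<Longrightarrow> U \<notin> R \<Longrightarrow> mobius X A U = 0"
  shows "mobius X A B = mobius (X \<inter> R) A B"
  using assms
proof (induction "card B" arbitrary: B rule: less_induct)
  case less
  show ?case
  proof (cases "A \<subset> B")
    case True
    have fin: "finite C" "card C < card B" if "C \<subset> B" for C
      using that less.prems(1) by (meson finite_subset psubset_imp_subset, meson psubset_card_mono)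
    have "mobius X A C = mobius (X \<inter> R) A C" if C: "C \<subset> B" for C
    proof (rule less.hyps[OF fin(2)[OF C] fin(1)[OF C]])
      show "mobius X A U = 0" if "A \<subset> U" "U \<subset> C" "U \<in> X" "U \<notin> R" for U
        using that C by (intro less.prems) auto
    qed
    moreover have "(\<Sum>C | A \<subseteq> C \<and> C \<subset> B \<and> (C = A \<or> C \<in> X). mobius X A C) =
      (\<Sum>C | A \<subseteq> C \<and> C \<subset> B \<and> (C = A \<or> C \<in> X \<inter> R). mobius X A C)"
      using less.prems by (intro sum.mono_neutral_right) (auto intro: finite_subset[of _ "Pow B"])
    ultimately have "(\<Sum>C | A \<subseteq> C \<and> C \<subset> B \<and> (C = A \<or> C \<in> X). mobius X A C) =
      (\<Sum>C | A \<subseteq> C \<and> C \<subset> B \<and> (C = A \<or> C \<in> X \<inter> R). mobius (X \<inter> R) A C)"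
      by simp
    then show ?thesis using mobius_psubset[OF less.prems(1) True] by simp
  next
    case False
    then show ?thesis by (simp add: mobius.simps[of _ A B])
  qed
qed

text \<open>Intersecting with \<open>T\<close> is an interior operator; as it maps no nonempty set to \<open>{}\<close>, it contracts the
  open interval below \<open>S\<close>.\<close>

lemma mobius_eq_0_if_Int_closed:
  assumes "finite S" "S \<in> X" "\<not> S \<subseteq> T"
    and closed: "\<And>U. U \<in> X \<Longrightarrow> U \<subseteq> S \<Longrightarrow> U \<noteq> {} \<Longrightarrow> U \<inter> T \<in> X \<and> U \<inter> T \<noteq> {}"
  shows "mobius X {} S = 0"
proof -
  have "mobius X {} U = 0" if "U \<in> X" "U \<subseteq> S" "\<not> U \<subseteq> T" for U
    using that
  proof (induction "card U" arbitrary: U rule: less_induct)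
    case less
    have fin: "finite U" using less.prems assms(1) finite_subset by blast
    have ne: "U \<noteq> {}" using less.prems by auto
    have V: "U \<inter> T \<in> X" "{} \<subset> U \<inter> T" using closed[OF less.prems(1,2) ne] by auto
    have zero: "mobius X {} C = 0" if "C \<subset> U" "C \<in> X" "\<not> C \<subseteq> T" for C
      using less.hyps[of C] that less.prems psubset_card_mono[OF fin that(1)] by auto
    have "mobius X {} U = - (\<Sum>C | {} \<subseteq> C \<and> C \<subset> U \<and> (C = {} \<or> C \<in> X). mobius X {} C)"
      using fin ne by (intro mobius_psubset) auto
    \<comment> \<open>By induction only the sets inside \<open>T\<close> contribute. They form an
      interval with greatest element \<open>U \<inter> T\<close>, over which the Moebius numbers sum
      to zero.\<close>
    also have "(\<Sum>C | {} \<subseteq> C \<and> C \<subset> U \<and> (C = {} \<or> C \<in> X). mobius X {} C) =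
        (\<Sum>C | {} \<subseteq> C \<and> C \<subseteq> U \<inter> T \<and> (C = {} \<or> C \<in> X). mobius X {} C)"
      using fin zero less.prems
      by (intro sum.mono_neutral_right) (auto intro: finite_subset[of _ "Pow U"])
    also have "\<dots> = 0" using fin V by (intro sum_mobius_below) auto
    finally show ?case by simp
  qed
  then show ?thesis using assms by simp
qed

text \<open>The dual contraction, by the closure operator \<open>insert e\<close>.\<close>

lemma mobius_eq_0_if_insert_closed:
  assumes "finite B" "e \<in> B" "{e} \<in> X" "B - {e} \<notin> X" "B \<noteq> {e}"
    and closed: "\<And>U. U \<in> X \<Longrightarrow> U \<subseteq> B \<Longrightarrow> insert e U \<in> X"
  shows "mobius X {} B = 0"
proof -
  let ?X = "insert {} X"
  \<comment> \<open>\<open>G V\<close> sums the Moebius numbers over the fibre of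
    \<open>insert e\<close> above \<open>V\<close>, which consists of \<open>V\<close> and, if
    present, \<open>V - {e}\<close>. The recursion for \<open>mobius\<close> shows that all these
    fibre sums vanish.\<close>
  define G where "G V = mobius X {} V + (if V - {e} \<in> ?X then mobius X {} (V - {e}) else 0)" for V
  have "G V = 0" if "V \<subseteq> B" "e \<in> V" for V
    using that
  proof (induction "card V" arbitrary: V rule: less_induct)
    case less
    have fin: "finite V" using less.prems assms(1) finite_subset by blast
    let ?I = "{C. C \<subset> V \<and> C \<in> ?X}"
    let ?D = "{C. C \<subset> V \<and> C \<in> ?X \<and> e \<in> C}"
    let ?N = "{C. C \<subset> V \<and> C \<in> ?X \<and> e \<notin> C}"
    have finI: "finite ?D" "finite ?N" using fin by (auto intro: finite_subset[of _ "Pow V"])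
    have "mobius X {} V = - (\<Sum>C\<in>?I. mobius X {} C)"
      using mobius_psubset[of V "{}" X] fin less.prems by auto
    also have "?I = ?D \<union> ?N" by auto
    also have "(\<Sum>C\<in>?D \<union> ?N. mobius X {} C) = (\<Sum>C\<in>?D. mobius X {} C) + (\<Sum>C\<in>?N. mobius X {} C)"
      using finI by (intro sum.union_disjoint) auto
    also have "(\<Sum>C\<in>?N. mobius X {} C) =
        (\<Sum>C\<in>?N - {V - {e}}. mobius X {} C) + (if V - {e} \<in> ?X then mobius X {} (V - {e}) else 0)"
    proof (cases "V - {e} \<in> ?X")
      case True
      then have "V - {e} \<in> ?N" using less.prems by auto
      from sum.remove[OF finI(2) this, of "mobius X {}"] show ?thesis using True by simp
    qed auto
    \<comment> \<open>Each \<open>C\<close> without \<open>e\<close> is paired with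
      \<open>insert e C\<close>, which lies in \<open>X\<close> by closure, or by the assumption on
      \<open>{e}\<close> if \<open>C\<close> is empty. Excluding \<open>V - {e}\<close> keeps the
      partner strictly below \<open>V\<close>.\<close>
    also have "(\<Sum>C\<in>?N - {V - {e}}. mobius X {} C) = (\<Sum>C | C \<in> ?D \<and> C - {e} \<in> ?X. mobius X {} (C - {e}))"
    proof (rule sum.reindex_bij_witness[of _ "\<lambda>C. C - {e}" "insert e"])
      fix C assume C: "C \<in> ?N - {V - {e}}"
      then have "insert e C \<in> X" using assms(3) closed[of C] less.prems by auto
      moreover have "insert e C \<subset> V" using C less.prems by auto
      ultimately show "insert e C \<in> {C. C \<in> ?D \<and> C - {e} \<in> ?X}" using C by auto
    qed (use less.prems in auto)
    also have "\<dots> = (\<Sum>C\<in>?D. if C - {e} \<in> ?X then mobius X {} (C - {e}) else 0)"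
      using finI(1) by (subst sum.inter_filter) auto
    finally have "G V = - (\<Sum>C\<in>?D. G C)"
      by (simp add: G_def sum.distrib)
    also have "(\<Sum>C\<in>?D. G C) = 0"
      using less fin by (intro sum.neutral) (auto intro!: less.hyps psubset_card_mono)
    finally show ?case by simp
  qed
  from this[of B] have "G B = 0" using assms(2) by simp
  \<comment> \<open>As \<open>B - {e}\<close> is neither the bottom nor in \<open>X\<close>, the
    fibre sum at \<open>B\<close> is the Moebius number of \<open>B\<close> alone.\<close>
  moreover have "B - {e} \<noteq> {}" using assms(2,5) by auto
  ultimately show ?thesis using assms(4) by (simp add: G_def)
qed

section \<open>Chains of sets and Philip Hall's theorem\<close>

definition set_chains :: "'a set set \<Rightarrow> 'a set \<Rightarrow> 'a set \<Rightarrow> 'a set list set" where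
  "set_chains X A B = {Ss. Ss \<noteq> [] \<and> hd Ss = A \<and> last Ss = B \<and> sorted_wrt (\<subset>) Ss \<and>
     set (butlast (tl Ss)) \<subseteq> X}"

lemma set_chains_self: "set_chains X A A = {[A]}"
proof -
  have "Ss = [A]" if "Ss \<in> set_chains X A A" for Ss
  proof (cases Ss)
    case (Cons S Ss')
    then show ?thesis using that by (cases "Ss' = []") (auto simp: set_chains_def)
  qed (use that in \<open>auto simp: set_chains_def\<close>)
  then show ?thesis by (auto simp: set_chains_def)
qed

text \<open>The last but one member of a chain runs over exactly the index set of the recursion for
  \<open>mobius\<close>.\<close>

lemma set_chains_snoc:
  assumes "A \<subset> B"
  shows "set_chains X A B =
    (\<lambda>(C, Cs). Cs @ [B]) ` Sigma {C. A \<subseteq> C \<and> C \<subset> B \<and> (C = A \<or> C \<in> X)} (set_chains X A)"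
    (is "?L = ?R")
proof
  show "?R \<subseteq> ?L"
  proof
    fix Ss assume "Ss \<in> ?R"
    then obtain C Cs where Ss: "Ss = Cs @ [B]"
      and p: "(C, Cs) \<in> Sigma {C. A \<subseteq> C \<and> C \<subset> B \<and> (C = A \<or> C \<in> X)} (set_chains X A)"
      by (metis (no_types, lifting) imageE case_prod_conv surj_pair)
    have C: "C \<subset> B" "C = A \<or> C \<in> X" using p by simp_all
    have "Cs \<in> set_chains X A C" using p by simp
    then have Cs: "Cs \<noteq> []" "hd Cs = A" "last Cs = C" "sorted_wrt (\<subset>) Cs" "set (butlast (tl Cs)) \<subseteq> X"
      by (simp_all add: set_chains_def)
    obtain Cs' where "Cs = Cs' @ [C]" using Cs(1,3) by (metis append_butlast_last_id)
    then have "S \<subseteq> C" if "S \<in> set Cs" for S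
      using Cs(4) that by (auto simp: sorted_wrt_append)
    then have "sorted_wrt (\<subset>) Ss" using C Cs Ss by (auto simp: sorted_wrt_append)
    moreover have "set (tl Cs) \<subseteq> X"
    proof (cases "tl Cs = []")
      case False
      then obtain D Ds where D: "Cs = D # Ds" "Ds \<noteq> []" by (cases Cs) auto
      then have "D \<subset> C" using Cs by auto
      then have "C \<in> X" using C Cs D by auto
      moreover have "tl Cs = butlast (tl Cs) @ [C]"
        using D Cs(3) by (metis append_butlast_last_id last_ConsR list.sel(3))
      ultimately show ?thesis using Cs(5) by (metis Un_insert_right insert_subset list.simps(15) set_append sup_bot_right empty_set)
    qed simp
    ultimately show "Ss \<in> ?L" using Ss Cs by (simp add: set_chains_def butlast_append)
  qed
  show "?L \<subseteq> ?R"
  proof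
    fix Ss assume L: "Ss \<in> ?L"
    then have "Ss \<noteq> []" "last Ss = B" by (simp_all add: set_chains_def)
    then obtain Cs where Ss: "Ss = Cs @ [B]" by (metis append_butlast_last_id)
    have ne: "Cs \<noteq> []" using L Ss assms by (auto simp: set_chains_def)
    have Cs: "hd Cs = A" "sorted_wrt (\<subset>) Cs" "set (tl Cs) \<subseteq> X" "\<forall>S\<in>set Cs. S \<subset> B"
      using L Ss ne by (auto simp: set_chains_def sorted_wrt_append butlast_append)
    have "A \<subseteq> last Cs \<and> (last Cs = A \<or> last Cs \<in> X)"
    proof (cases "tl Cs = []")
      case True
      then show ?thesis using ne Cs by (cases Cs) auto
    next
      case False
      then obtain D Ds where D: "Cs = D # Ds" "Ds \<noteq> []" by (cases Cs) auto
      then have "last Cs \<in> set Ds" "hd Cs = D" "last Cs = last Ds" by simp_all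
      then show ?thesis using Cs D(1) by auto
    qed
    moreover have "Cs \<in> set_chains X A (last Cs)"
      using ne Cs by (auto simp: set_chains_def dest: in_set_butlastD)
    ultimately show "Ss \<in> ?R"
      using Ss ne Cs by (intro image_eqI[of _ _ "(last Cs, Cs)"]) auto
  qed
qed

text \<open>Philip Hall's theorem. As in \<open>mobius\<close>, only the interior members of a chain
  have to lie in \<open>X\<close>. Appending \<open>B\<close> lengthens a chain by one, which gives
  the sign in the recursion.\<close>

lemma sum_set_chains:
  assumes "finite B" "A \<subseteq> B"
  shows "finite (set_chains X A B) \<and> (\<Sum>Ss\<in>set_chains X A B. (-1) ^ (length Ss - 1)) = mobius X A B"
  using assms
proof (induction "card B" arbitrary: B rule: less_induct)
  case less
  show ?case
  proof (cases "A = B")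
    case True
    then show ?thesis by (simp add: set_chains_self)
  next
    case False
    then have AB: "A \<subset> B" using less.prems by auto
    let ?I = "{C. A \<subseteq> C \<and> C \<subset> B \<and> (C = A \<or> C \<in> X)}"
    have finI: "finite ?I" using less.prems by (auto intro: finite_subset[of _ "Pow B"])
    have IH: "finite (set_chains X A C)"
      "(\<Sum>Ss\<in>set_chains X A C. (-1) ^ (length Ss - 1)) = mobius X A C" if "C \<in> ?I" for C
      using less.hyps[of C] that less.prems by (auto intro: psubset_card_mono finite_subset)
    have inj: "inj_on (\<lambda>(C, Cs). Cs @ [B]) (Sigma ?I (set_chains X A))"
      by (auto simp: inj_on_def set_chains_def)
    have "(\<Sum>Ss\<in>set_chains X A B. (-1) ^ (length Ss - 1)) =
        (\<Sum>(C, Cs)\<in>Sigma ?I (set_chains X A). (-1) ^ length Cs :: int)"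
      unfolding set_chains_snoc[OF AB] by (subst sum.reindex[OF inj]) (simp add: split_def)
    also have "\<dots> = (\<Sum>C\<in>?I. \<Sum>Cs\<in>set_chains X A C. (-1) ^ length Cs)"
      using finI IH by (subst sum.Sigma) auto
    also have "\<dots> = (\<Sum>C\<in>?I. - mobius X A C)"
    proof (intro sum.cong refl)
      fix C assume C: "C \<in> ?I"
      have "(\<Sum>Cs\<in>set_chains X A C. (-1) ^ length Cs :: int) =
          (\<Sum>Cs\<in>set_chains X A C. - ((-1) ^ (length Cs - 1)))"
      proof (intro sum.cong refl)
        fix Cs assume "Cs \<in> set_chains X A C"
        then have "Cs \<noteq> []" by (simp add: set_chains_def)
        then show "(-1) ^ length Cs = - ((-1) ^ (length Cs - 1) :: int)" by (cases Cs) auto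
      qed
      then show "(\<Sum>Cs\<in>set_chains X A C. (-1) ^ length Cs) = - mobius X A C"
        using IH(2)[OF C] by (simp add: sum_negf)
    qed
    also have "\<dots> = mobius X A B"
      using mobius_psubset[OF less.prems(1) AB, of X] by (simp add: sum_negf)
    finally show ?thesis
      using finI IH(1) by (simp add: set_chains_snoc[OF AB] finite_imageI finite_SigmaI del: mem_Collect_eq)
  qed
qed

section \<open>Flag monomials\<close>

text \<open>\<open>A\<close> accumulates the elements already read, so the exponents are the
  increments of \<open>\<delta>\<close> along the flag. The subtraction is truncated and has its
  intended meaning when \<open>\<delta>\<close> increases along the flag.\<close>

fun flag_monomial :: "('a \<Rightarrow> 'k::field) \<Rightarrow> ('a set \<Rightarrow> nat) \<Rightarrow> 'a set \<Rightarrow> 'a list \<Rightarrow> 'k" where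
  "flag_monomial z \<delta> A [] = 1"
| "flag_monomial z \<delta> A (a # w) =
     z a ^ (\<delta> (insert a A) - \<delta> A) * flag_monomial z \<delta> (insert a A) w"

lemma flag_monomial_append:
  "flag_monomial z \<delta> A (u @ v) = flag_monomial z \<delta> A u * flag_monomial z \<delta> (A \<union> set u) v"
  by (induction u arbitrary: A) auto

lemma flag_monomial_cong:
  assumes "\<And>k. k \<le> length w \<Longrightarrow> \<delta> (A \<union> set (take k w)) = \<delta>' (A \<union> set (take k w))"
  shows "flag_monomial z \<delta> A w = flag_monomial z \<delta>' A w"
  using assms
proof (induction w arbitrary: A)
  case (Cons a w)
  have "\<delta> (insert a A \<union> set (take k w)) = \<delta>' (insert a A \<union> set (take k w))" if "k \<le> length w" for k
    using Cons.prems[of "Suc k"] that by simp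
  moreover have "\<delta> A = \<delta>' A" using Cons.prems[of 0] by simp
  moreover have "\<delta> (insert a A) = \<delta>' (insert a A)" using Cons.prems[of 1] by simp
  ultimately show ?case using Cons.IH by simp
qed simp

definition flag_sum :: "('a \<Rightarrow> 'k::field) \<Rightarrow> ('a set \<Rightarrow> nat) \<Rightarrow> 'a set \<Rightarrow> 'a set \<Rightarrow> 'k" where
  "flag_sum z \<delta> A B =
     (\<Sum>w\<in>permutations_of_set (B - A). flag_monomial z \<delta> A w * path_weight z w)"

text \<open>Only flags through \<open>U\<close> see the change. For such an ordering
  \<open>u @ v\<close>, let \<open>l\<close> be the last element of \<open>u\<close> and
  \<open>f\<close> the first of \<open>v\<close>. Lowering \<open>\<delta> U\<close> moves one
  factor from \<open>z l\<close> to \<open>z f\<close>, so the two monomials differ by a common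
  monomial times \<open>z l - z f\<close>. This cancels the denominator joining \<open>u\<close> to
  \<open>v\<close>, and the rest factors.\<close>

lemma flag_sum_diff:
  assumes fin: "finite B" and sub: "A \<subset> U" "U \<subset> B" and inj: "inj_on z (B - A)"
    and pos: "0 < \<delta> U"
    and below: "\<And>C. A \<subseteq> C \<Longrightarrow> C \<subset> U \<Longrightarrow> \<delta> C < \<delta> U"
    and above: "\<And>C. U \<subset> C \<Longrightarrow> C \<subseteq> B \<Longrightarrow> \<delta> U \<le> \<delta> C"
    and \<delta>': "\<delta>' = \<delta>(U := \<delta> U - 1)"
  shows "flag_sum z \<delta> A B = flag_sum z \<delta>' A B + flag_sum z \<delta>' A U * flag_sum z \<delta> U B"
proof -
  let ?f = "\<lambda>\<delta> A w. flag_monomial z \<delta> A w * path_weight z w"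
  let ?P = "permutations_of_set (B - A)"
  let ?W = "{w \<in> ?P. set (take (card (U - A)) w) = U - A}"
  have "flag_sum z \<delta> A B - flag_sum z \<delta>' A B = (\<Sum>w\<in>?P. ?f \<delta> A w - ?f \<delta>' A w)"
    by (simp add: flag_sum_def sum_subtractf)
  also have "\<dots> = (\<Sum>w\<in>?W. ?f \<delta> A w - ?f \<delta>' A w)"
  proof (rule sum.mono_neutral_right)
    show "\<forall>w\<in>?P - ?W. ?f \<delta> A w - ?f \<delta>' A w = 0"
    proof
      fix w assume w: "w \<in> ?P - ?W"
      have "A \<union> set (take k w) \<noteq> U" if "k \<le> length w" for k
      proof
        assume "A \<union> set (take k w) = U"
        moreover have "set (take k w) \<subseteq> B - A"
          using w set_take_subset[of k w] by (auto simp: permutations_of_set_def)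
        ultimately have eq: "set (take k w) = U - A" by blast
        moreover have "distinct (take k w)" using w by (auto simp: permutations_of_set_def)
        ultimately have "card (U - A) = k" using that by (metis distinct_card length_take min.absorb2)
        then show False using w eq by auto
      qed
      then have "flag_monomial z \<delta> A w = flag_monomial z \<delta>' A w"
        by (intro flag_monomial_cong) (simp add: \<delta>')
      then show "?f \<delta> A w - ?f \<delta>' A w = 0" by simp
    qed
  qed auto
  also have "\<dots> = (\<Sum>u\<in>permutations_of_set (U - A). \<Sum>v\<in>permutations_of_set (B - A - (U - A)).
      ?f \<delta> A (u @ v) - ?f \<delta>' A (u @ v))"
    using fin sub by (intro sum_permutations_of_set_prefix) auto
  also have "\<dots> = (\<Sum>u\<in>permutations_of_set (U - A). \<Sum>v\<in>permutations_of_set (B - U).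
      ?f \<delta>' A u * ?f \<delta> U v)"
  proof (intro sum.cong refl)
    show eqB: "permutations_of_set (B - A - (U - A)) = permutations_of_set (B - U)"
      using sub by (intro arg_cong[of _ _ permutations_of_set]) auto
    fix u v
    assume u: "u \<in> permutations_of_set (U - A)" and v: "v \<in> permutations_of_set (B - U)"
    have su: "set u = U - A" "distinct u" and sv: "set v = B - U"
      using u v by (auto simp: permutations_of_set_def)
    have "u \<noteq> []" "v \<noteq> []" using su sv sub by auto
    then obtain u' l f v' where ul: "u = u' @ [l]" and vf: "v = f # v'"
      by (metis append_butlast_last_id neq_Nil_conv)
    have AU: "A \<union> set u = U" "insert l (A \<union> set u') = U" using su sub ul by auto
    have l: "l \<in> U - A" "l \<notin> A \<union> set u'" using su ul by auto
    have f: "f \<in> B - U" using sv vf by auto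
    have "z l \<noteq> z f" using l f sub inj by (auto dest: inj_onD)
    have "flag_monomial z \<delta> A u' = flag_monomial z \<delta>' A u'"
    proof (rule flag_monomial_cong)
      fix k
      have "l \<notin> A \<union> set (take k u')" using l set_take_subset[of k u'] by blast
      then show "\<delta> (A \<union> set (take k u')) = \<delta>' (A \<union> set (take k u'))"
        using l unfolding \<delta>' by auto
    qed
    moreover have "A \<union> set u' \<subset> U" using AU l by auto
    then have "\<delta> (A \<union> set u') < \<delta> U" by (intro below) auto
    \<comment> \<open>Strict growth at \<open>U\<close> makes the exponent of \<open>z l\<close>
      positive, so that a factor can be split off despite truncation.\<close>
    then have "\<delta> U - \<delta> (A \<union> set u') = Suc (\<delta> U - 1 - \<delta> (A \<union> set u'))" by simp
    ultimately have mu: "flag_monomial z \<delta> A u = z l * flag_monomial z \<delta>' A u"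
      using AU l unfolding ul \<delta>' by (auto simp: flag_monomial_append)
    have "flag_monomial z \<delta> (insert f U) v' = flag_monomial z \<delta>' (insert f U) v'"
    proof (rule flag_monomial_cong)
      fix k
      show "\<delta> (insert f U \<union> set (take k v')) = \<delta>' (insert f U \<union> set (take k v'))"
        using f unfolding \<delta>' by auto
    qed
    moreover have "\<delta> U \<le> \<delta> (insert f U)" using f sub by (intro above) auto
    then have "\<delta> (insert f U) - (\<delta> U - 1) = Suc (\<delta> (insert f U) - \<delta> U)" using pos by simp
    moreover have "insert f U \<noteq> U" using f by auto
    ultimately have mv: "flag_monomial z \<delta>' U v = z f * flag_monomial z \<delta> U v"
      unfolding vf \<delta>' by simp
    have p: "path_weight z (u @ v) = path_weight z u * path_weight z v / (z l - z f)"
      using path_weight_append[of u v z] ul vf by simp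
    have "?f \<delta> A (u @ v) - ?f \<delta>' A (u @ v) =
        ((z l - z f) * flag_monomial z \<delta>' A u * flag_monomial z \<delta> U v) * path_weight z (u @ v)"
      unfolding flag_monomial_append AU mu mv by (simp add: algebra_simps)
    also have "\<dots> = ?f \<delta>' A u * ?f \<delta> U v"
      unfolding p using \<open>z l \<noteq> z f\<close> by (simp add: field_simps)
    finally show "?f \<delta> A (u @ v) - ?f \<delta>' A (u @ v) = ?f \<delta>' A u * ?f \<delta> U v" .
  qed
  also have "\<dots> = flag_sum z \<delta>' A U * flag_sum z \<delta> U B"
    unfolding flag_sum_def sum_product ..
  finally show ?thesis by (simp add: algebra_simps)
qed

text \<open>The condition that \<delta>(S) is at least |S|, taken relative to the base
  \<open>A\<close>.\<close>

definition heavy_sets :: "('a set \<Rightarrow> nat) \<Rightarrow> 'a set \<Rightarrow> 'a set set" where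
  "heavy_sets \<delta> A = {C. \<delta> A + card (C - A) \<le> \<delta> C}"

text \<open>Lexicographic induction: \<open>flag_sum_diff\<close> either lowers the total of
  \<open>\<delta>\<close> on the same interval or passes to the shorter intervals from
  \<open>A\<close> to \<open>U\<close> and from \<open>U\<close> to \<open>B\<close>. If
  \<open>\<delta>\<close> is constant strictly below \<open>B\<close>, the monomial is a power of
  the last variable and Lagrange interpolation applies. The product term survives only if
  \<open>U\<close> meets the bound in \<open>heavy_sets\<close> with equality. Exactly then lowering
  removes \<open>U\<close> from the heavy sets, and \<open>mobius_split\<close> gives the matching
  term.\<close>

lemma flag_sum_eq_mobius:
  assumes "finite B" "A \<subset> B" "inj_on z (B - A)"
    and "\<And>C D. A \<subseteq> C \<Longrightarrow> C \<subseteq> D \<Longrightarrow> D \<subseteq> B \<Longrightarrow> \<delta> C \<le> \<delta> D"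
    and "\<delta> B < \<delta> A + card (B - A)"
  shows "flag_sum z \<delta> A B =
    (if Suc (\<delta> B) = \<delta> A + card (B - A)
     then (-1) ^ card (B - A) * of_int (mobius (heavy_sets \<delta> A) A B) else 0)"
  using assms
proof (induction "(card (B - A), \<Sum>C\<in>Pow B. \<delta> C)" arbitrary: A B \<delta>
    rule: wf_induct_rule[OF wf_lex_prod[OF wf_less_than wf_less_than]])
  case (1 A B \<delta>)
  note prems = "1.prems" and mono = "1.prems"(4)
  have IH: "flag_sum z \<delta>' A' B' =
    (if Suc (\<delta>' B') = \<delta>' A' + card (B' - A')
     then (-1) ^ card (B' - A') * of_int (mobius (heavy_sets \<delta>' A') A' B') else 0)"
    if "((card (B' - A'), \<Sum>C\<in>Pow B'. \<delta>' C), (card (B - A), \<Sum>C\<in>Pow B. \<delta> C)) \<in> less_than <*lex*> less_than"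
      "A' \<subset> B'" "A \<subseteq> A'" "B' \<subseteq> B"
      "\<And>C D. A' \<subseteq> C \<Longrightarrow> C \<subseteq> D \<Longrightarrow> D \<subseteq> B' \<Longrightarrow> \<delta>' C \<le> \<delta>' D"
      "\<delta>' B' < \<delta>' A' + card (B' - A')" for A' B' \<delta>'
  proof (rule "1.hyps"[OF that(1) _ that(2) _ that(5,6)])
    show "finite B'" using that prems by (auto intro: finite_subset)
    have "B' - A' \<subseteq> B - A" using that by auto
    then show "inj_on z (B' - A')" using prems by (auto intro: inj_on_subset)
  qed
  have "\<delta> A \<le> \<delta> B" using prems by (intro mono) auto
  show ?case
  proof (cases "\<exists>C. A \<subset> C \<and> C \<subset> B \<and> \<delta> A < \<delta> C")
    case False
    then have flat: "\<delta> C = \<delta> A" if "A \<subseteq> C" "C \<subset> B" for C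
      using that mono[of A C] by (metis le_neq_implies_less order_refl psubset_eq)
    have "flag_monomial z \<delta> A w = z (last w) ^ (\<delta> B - \<delta> A)" if w: "w \<in> permutations_of_set (B - A)" for w
    proof -
      have "set w = B - A" using w by (auto simp: permutations_of_set_def)
      then have "w \<noteq> []" using prems by auto
      then obtain v l where vl: "w = v @ [l]" by (metis append_butlast_last_id)
      have "distinct w" using w by (auto simp: permutations_of_set_def)
      then have l: "l \<in> B" "l \<notin> A \<union> set v" "insert l (A \<union> set v) = B" "A \<union> set v \<subset> B"
        using \<open>set w = B - A\<close> vl prems(2) by auto
      have "flag_monomial z \<delta> A v = flag_monomial z (\<lambda>_. 0) A v"
      proof -
        have "flag_monomial z \<delta> A v = flag_monomial z (\<lambda>_. \<delta> A) A v"
        proof (rule flag_monomial_cong)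
          fix k
          have "A \<union> set (take k v) \<subset> B" using l set_take_subset[of k v] by auto
          then show "\<delta> (A \<union> set (take k v)) = \<delta> A" by (intro flat) auto
        qed
        also have "flag_monomial z (\<lambda>_. \<delta> A) C v = flag_monomial z (\<lambda>_. 0) C v" for C
          by (induction v arbitrary: C) auto
        finally show ?thesis .
      qed
      moreover have "flag_monomial z (\<lambda>_. 0) C v = 1" for C
        by (induction v arbitrary: C) auto
      ultimately show ?thesis using l flat[of "A \<union> set v"] by (simp add: vl flag_monomial_append)
    qed
    then have "flag_sum z \<delta> A B =
        (\<Sum>w\<in>permutations_of_set (B - A). z (last w) ^ (\<delta> B - \<delta> A) * path_weight z w)"
      by (simp add: flag_sum_def)
    also have "\<dots> = (if Suc (\<delta> B - \<delta> A) = card (B - A) then (-1) ^ (\<delta> B - \<delta> A) else 0)"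
    proof (rule sum_power_last_path_weight)
      show "\<delta> B - \<delta> A < card (B - A)" using \<open>\<delta> A \<le> \<delta> B\<close> prems(5) by simp
    qed (use prems in auto)
    finally have fs: "flag_sum z \<delta> A B =
      (if Suc (\<delta> B - \<delta> A) = card (B - A) then (-1) ^ (\<delta> B - \<delta> A) else 0)" .
    have "C \<notin> heavy_sets \<delta> A" if "A \<subset> C" "C \<subset> B" for C
    proof -
      have "card (C - A) > 0" using that prems by (auto simp: card_gt_0_iff intro: finite_subset)
      then show ?thesis using flat[of C] that by (auto simp: heavy_sets_def)
    qed
    then have "{C. A \<subseteq> C \<and> C \<subset> B \<and> (C = A \<or> C \<in> heavy_sets \<delta> A)} = {A}"
      using prems by auto
    then have "mobius (heavy_sets \<delta> A) A B = -1"
      using prems by (subst mobius_psubset) auto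
    moreover have "Suc (\<delta> B - \<delta> A) = card (B - A) \<longleftrightarrow> Suc (\<delta> B) = \<delta> A + card (B - A)"
      using \<open>\<delta> A \<le> \<delta> B\<close> by auto
    moreover have "(-1) ^ card (B - A) * (-1 :: 'b) = (-1) ^ (\<delta> B - \<delta> A)"
      if "Suc (\<delta> B - \<delta> A) = card (B - A)"
      by (simp flip: that)
    ultimately show ?thesis unfolding fs by simp
  next
    case True
    \<comment> \<open>A set of least cardinality is chosen so that \<open>\<delta>\<close> equals
      \<open>\<delta> A\<close> strictly between \<open>A\<close> and \<open>U\<close>. Then
      lowering the value at \<open>U\<close> preserves monotonicity.\<close>
    then have "\<exists>U. (A \<subset> U \<and> U \<subset> B \<and> \<delta> A < \<delta> U) \<and>
        (\<forall>C. A \<subset> C \<and> C \<subset> B \<and> \<delta> A < \<delta> C \<longrightarrow> card U \<le> card C)"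
      by (elim exE) (rule ex_has_least_nat)
    then obtain U where "(A \<subset> U \<and> U \<subset> B \<and> \<delta> A < \<delta> U) \<and>
        (\<forall>C. A \<subset> C \<and> C \<subset> B \<and> \<delta> A < \<delta> C \<longrightarrow> card U \<le> card C)" by (elim exE)
    then have U: "A \<subset> U" "U \<subset> B" "\<delta> A < \<delta> U"
      and min': "\<forall>C. A \<subset> C \<and> C \<subset> B \<and> \<delta> A < \<delta> C \<longrightarrow> card U \<le> card C"
      by simp_all
    have min: "card U \<le> card C" if "A \<subset> C" "C \<subset> B" "\<delta> A < \<delta> C" for C
      using min' that by simp
    define \<delta>' where "\<delta>' = \<delta>(U := \<delta> U - 1)"
    have finU: "finite U" using U prems by (auto intro: finite_subset)
    have below: "\<delta> C = \<delta> A" if "A \<subseteq> C" "C \<subset> U" for C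
    proof (rule ccontr)
      assume ne: "\<delta> C \<noteq> \<delta> A"
      have "C \<subset> B" using that(2) U(2) by blast
      then have "\<delta> A \<le> \<delta> C" by (intro mono that(1)) auto
      then have "\<delta> A < \<delta> C" using ne by simp
      moreover have "A \<subset> C" using ne that(1) by blast
      ultimately have "card U \<le> card C" using \<open>C \<subset> B\<close> by (intro min)
      then show False using psubset_card_mono[OF finU that(2)] by simp
    qed
    have mono': "\<delta>' C \<le> \<delta>' D" if "A \<subseteq> C" "C \<subseteq> D" "D \<subseteq> B" for C D
    proof (cases "D = U \<and> C \<noteq> U")
      case True
      then have "\<delta> C = \<delta> A" using that by (intro below) auto
      then show ?thesis using True U by (simp add: \<delta>'_def)
    next
      case False
      have "\<delta> C \<le> \<delta> D" using that by (rule mono)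
      then show ?thesis using False by (auto simp: \<delta>'_def)
    qed
    have \<delta>'AB: "\<delta>' A = \<delta> A" "\<delta>' B = \<delta> B" "\<delta>' U = \<delta> U - 1" using U by (auto simp: \<delta>'_def)
    have cards: "card (B - A) = card (U - A) + card (B - U)" "0 < card (U - A)" "0 < card (B - U)"
    proof -
      have "B - A = (U - A) \<union> (B - U)" "(U - A) \<inter> (B - U) = {}" using U by auto
      then show "card (B - A) = card (U - A) + card (B - U)"
        using card_Un_disjoint[of "U - A" "B - U"] prems(1) finU by simp
      show "0 < card (U - A)" "0 < card (B - U)" using U finU prems by (auto simp: card_gt_0_iff)
    qed
    have split: "flag_sum z \<delta> A B = flag_sum z \<delta>' A B + flag_sum z \<delta>' A U * flag_sum z \<delta> U B"
    proof (rule flag_sum_diff)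
      show "\<delta> C < \<delta> U" if "A \<subseteq> C" "C \<subset> U" for C using below[OF that] U by simp
      show "\<delta> U \<le> \<delta> C" if "U \<subset> C" "C \<subseteq> B" for C using that U by (intro mono) auto
      show "0 < \<delta> U" using U by simp
    qed (fact prems U \<delta>'_def)+
    have F': "flag_sum z \<delta>' A B =
      (if Suc (\<delta> B) = \<delta> A + card (B - A)
       then (-1) ^ card (B - A) * of_int (mobius (heavy_sets \<delta>' A) A B) else 0)"
    proof -
      have "(\<Sum>C\<in>Pow B. \<delta>' C) < (\<Sum>C\<in>Pow B. \<delta> C)"
        using U prems by (intro sum_strict_mono_ex1) (auto simp: \<delta>'_def)
      then have "((card (B - A), \<Sum>C\<in>Pow B. \<delta>' C), (card (B - A), \<Sum>C\<in>Pow B. \<delta> C))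
          \<in> less_than <*lex*> less_than" by simp
      from IH[OF this prems(2) order_refl order_refl mono'] show ?thesis
        using prems(5) by (simp add: \<delta>'AB)
    qed
    \<comment> \<open>Since \<open>\<delta>' U\<close> is one less than \<open>\<delta> U\<close>,
      the top degree on this interval is reached when \<open>U\<close> is heavy with
      equality.\<close>
    have FU: "flag_sum z \<delta>' A U =
      (if \<delta> U = \<delta> A + card (U - A)
       then (-1) ^ card (U - A) * of_int (mobius (heavy_sets \<delta>' A) A U) else 0)"
      if "\<delta> U \<le> \<delta> A + card (U - A)"
    proof -
      have "\<delta>' C \<le> \<delta>' D" if "A \<subseteq> C" "C \<subseteq> D" "D \<subseteq> U" for C D
        using that U by (intro mono') auto
      moreover have "((card (U - A), \<Sum>C\<in>Pow U. \<delta>' C), (card (B - A), \<Sum>C\<in>Pow B. \<delta> C))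
          \<in> less_than <*lex*> less_than" using cards by simp
      ultimately show ?thesis
        using IH[OF _ U(1) order_refl psubset_imp_subset[OF U(2)], of \<delta>'] that U(3) cards
        by (simp add: \<delta>'AB)
    qed
    have UF: "flag_sum z \<delta> U B =
      (if Suc (\<delta> B) = \<delta> U + card (B - U)
       then (-1) ^ card (B - U) * of_int (mobius (heavy_sets \<delta> U) U B) else 0)"
      if "\<delta> B < \<delta> U + card (B - U)"
    proof -
      have "\<delta> C \<le> \<delta> D" if "U \<subseteq> C" "C \<subseteq> D" "D \<subseteq> B" for C D
        using that U by (intro mono) auto
      moreover have "((card (B - U), \<Sum>C\<in>Pow B. \<delta> C), (card (B - A), \<Sum>C\<in>Pow B. \<delta> C))
          \<in> less_than <*lex*> less_than" using cards by simp
      ultimately show ?thesis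
        using IH[OF _ U(2) psubset_imp_subset[OF U(1)] order_refl, of \<delta>] that by simp
    qed
    have heavy': "heavy_sets \<delta>' A =
        (if \<delta> U = \<delta> A + card (U - A) then heavy_sets \<delta> A - {U} else heavy_sets \<delta> A)"
    proof (intro set_eqI)
      fix C
      show "C \<in> heavy_sets \<delta>' A \<longleftrightarrow> C \<in>
          (if \<delta> U = \<delta> A + card (U - A) then heavy_sets \<delta> A - {U} else heavy_sets \<delta> A)"
        using U(3) \<delta>'AB by (cases "C = U") (auto simp: heavy_sets_def \<delta>'_def)
    qed
    show ?thesis
    proof (cases "\<delta> U = \<delta> A + card (U - A)")
      case True
      have "mobius (heavy_sets \<delta> A) A B =
          mobius (heavy_sets \<delta> A - {U}) A B + mobius (heavy_sets \<delta> A) A U * mobius (heavy_sets \<delta> A) U B"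
        using True by (intro mobius_split prems U) (simp add: heavy_sets_def)
      also have "heavy_sets \<delta> A - {U} = heavy_sets \<delta>' A"
        using heavy' True by simp
      also have "mobius (heavy_sets \<delta> A) A U = mobius (heavy_sets \<delta>' A) A U"
        using heavy' by (intro mobius_cong finU) auto
      \<comment> \<open>As \<open>U\<close> meets the bound with equality, heaviness relative to
        \<open>A\<close> and relative to \<open>U\<close> agree for sets above
        \<open>U\<close>.\<close>
      also have "mobius (heavy_sets \<delta> A) U B = mobius (heavy_sets \<delta> U) U B"
      proof (intro mobius_cong prems(1))
        fix C assume C: "U \<subset> C" "C \<subset> B"
        then have "finite C" using prems(1) by (meson finite_subset psubset_imp_subset)
        moreover have "C - A = (U - A) \<union> (C - U)" "(U - A) \<inter> (C - U) = {}" using U C by auto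
        ultimately have "card (C - A) = card (U - A) + card (C - U)"
          using card_Un_disjoint[of "U - A" "C - U"] finU by simp
        then show "C \<in> heavy_sets \<delta> A \<longleftrightarrow> C \<in> heavy_sets \<delta> U"
          using True by (simp add: heavy_sets_def add.assoc)
      qed
      finally have "mobius (heavy_sets \<delta> A) A B = mobius (heavy_sets \<delta>' A) A B +
          mobius (heavy_sets \<delta>' A) A U * mobius (heavy_sets \<delta> U) U B" .
      moreover have "Suc (\<delta> B) = \<delta> U + card (B - U) \<longleftrightarrow> Suc (\<delta> B) = \<delta> A + card (B - A)"
        "\<delta> B < \<delta> U + card (B - U)" "\<delta> U \<le> \<delta> A + card (U - A)"
        using True prems(5) cards by linarith+
      ultimately show ?thesis
        unfolding split F' using True FU UF by (simp add: cards power_add algebra_simps)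
    next
      case False
      \<comment> \<open>If \<open>\<delta> U\<close> is below the bound, the first factor has too
        small a degree; if it is above, the second has.\<close>
      have "flag_sum z \<delta>' A U * flag_sum z \<delta> U B = 0"
      proof (cases "\<delta> U < \<delta> A + card (U - A)")
        case True
        then show ?thesis using FU by simp
      next
        case F: False
        then show ?thesis using False UF prems(5) cards by simp
      qed
      then show ?thesis unfolding split F' using heavy' False by simp
    qed
  qed
qed

section \<open>Elementary symmetric polynomials\<close>

lemma elem_sym_0 [simp]:
  assumes "finite A"
  shows "elem_sym 0 f A = 1"
proof -
  have "{X. X \<subseteq> A \<and> card X = 0} = {{}}"
    using assms by (auto dest: finite_subset)
  then show ?thesis by (simp add: elem_sym_def)
qed

lemma elem_sym_insert:
  assumes "finite A" "a \<notin> A"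
  shows "elem_sym (Suc k) f (insert a A) = elem_sym (Suc k) f A + f a * elem_sym k f A"
proof -
  let ?S = "\<lambda>k. {X. X \<subseteq> A \<and> card X = k}"
  have fin: "finite (?S k)" for k using assms by simp
  have 1: "finite X" "a \<notin> X" if "X \<in> ?S k" for X k
    using that assms by (auto dest: finite_subset)
  have "{X. X \<subseteq> insert a A \<and> card X = Suc k} = ?S (Suc k) \<union> insert a ` ?S k" (is "?L = ?R")
  proof
    show "?R \<subseteq> ?L" using 1 by auto
    show "?L \<subseteq> ?R"
    proof
      fix X assume X: "X \<in> ?L"
      show "X \<in> ?R"
      proof (cases "a \<in> X")
        case True
        then have "X = insert a (X - {a})" by auto
        moreover have "X - {a} \<in> ?S k" using X True assms by (auto simp: card_Diff_singleton)
        ultimately show ?thesis by blast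
      qed (use X in auto)
    qed
  qed
  then have "elem_sym (Suc k) f (insert a A) = (\<Sum>X\<in>?S (Suc k) \<union> insert a ` ?S k. prod f X)"
    by (simp add: elem_sym_def)
  also have "\<dots> = (\<Sum>X\<in>?S (Suc k). prod f X) + (\<Sum>X\<in>insert a ` ?S k. prod f X)"
    using fin 1(2) by (intro sum.union_disjoint) auto
  also have "inj_on (insert a) (?S k)"
    using 1(2) by (intro inj_onI) (metis insert_ident)
  then have "(\<Sum>X\<in>insert a ` ?S k. prod f X) = (\<Sum>X\<in>?S k. prod f (insert a X))"
    by (simp only: sum.reindex comp_def)
  also have "\<dots> = (\<Sum>X\<in>?S k. f a * prod f X)"
    by (intro sum.cong refl prod.insert 1)
  finally show ?thesis
    by (simp add: elem_sym_def sum_distrib_left)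
qed

lemma elem_sym_card:
  assumes "finite A"
  shows "elem_sym (card A) f A = prod f A"
proof -
  have "{X. X \<subseteq> A \<and> card X = card A} = {A}"
    using assms card_subset_eq by blast
  then show ?thesis by (simp add: elem_sym_def)
qed

text \<open>Divides the generating function of the elementary symmetric polynomials by \<open>1 + t f a\<close>.\<close>

lemma sum_elem_sym_insert:
  assumes "finite A" "a \<notin> A"
  shows "(\<Sum>j<Suc k. (- f a) ^ j * elem_sym (k - j) f (insert a A)) = elem_sym k f A"
proof (induction k)
  case 0
  then show ?case using assms by simp
next
  case (Suc k)
  have "(\<Sum>j<Suc (Suc k). (- f a) ^ j * elem_sym (Suc k - j) f (insert a A)) =
      elem_sym (Suc k) f (insert a A) - f a * (\<Sum>j<Suc k. (- f a) ^ j * elem_sym (k - j) f (insert a A))"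
    by (subst sum.lessThan_Suc_shift)
      (simp add: sum_distrib_left sum_negf mult.assoc del: sum.lessThan_Suc)
  then show ?case unfolding Suc using assms by (simp add: elem_sym_insert)
qed

text \<open>A boolean list is the indicator of a subset of \<open>cs\<close>. In this form the
  monomials of an elementary symmetric polynomial become lattice paths.\<close>

lemma elem_sym_list:
  assumes "distinct cs"
  shows "elem_sym k f (set cs) =
    (\<Sum>P | length P = length cs \<and> count_list P True = k. \<Prod>i<length cs. if P ! i then f (cs ! i) else 1)"
  using assms
proof (induction cs arbitrary: k)
  case Nil
  have "{P. length P = length [] \<and> count_list P True = k} = (if k = 0 then {[]} else {})" by auto
  moreover have "elem_sym k f {} = (if k = 0 then 1 else 0)"
    by (cases k) (auto simp: elem_sym_def cong: conj_cong)
  ultimately show ?case by simp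
next
  case (Cons c cs)
  let ?S = "\<lambda>k. {P. length P = length cs \<and> count_list P True = k}"
  let ?g = "\<lambda>cs P. \<Prod>i<length cs. if P ! i then f (cs ! i) else 1"
  have fin: "finite (?S k)" for k
    by (rule finite_subset[OF _ finite_lists_length_eq[of UNIV "length cs"]]) auto
  have g: "?g (c # cs) (b # P) = (if b then f c else 1) * ?g cs P" for b P
    by (simp add: prod.lessThan_Suc_shift del: prod.lessThan_Suc cong: if_cong)
  have S: "{P. length P = length (c # cs) \<and> count_list P True = k} =
      Cons False ` ?S k \<union> Cons True ` {P. length P = length cs \<and> Suc (count_list P True) = k}"
    (is "?L = ?R")
  proof
    show "?R \<subseteq> ?L" by auto
    show "?L \<subseteq> ?R"
    proof
      fix P assume P: "P \<in> ?L"
      then obtain b P' where "P = b # P'" by (cases P) auto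
      then show "P \<in> ?R" using P by (cases b) auto
    qed
  qed
  let ?T = "{P. length P = length cs \<and> Suc (count_list P True) = k}"
  have inj: "inj_on (Cons b) X" for b and X :: "bool list set" by (simp add: inj_on_def)
  have finT: "finite ?T"
    by (rule finite_subset[OF _ finite_lists_length_eq[of UNIV "length cs"]]) auto
  have "(\<Sum>P | length P = length (c # cs) \<and> count_list P True = k. ?g (c # cs) P) =
      (\<Sum>P\<in>Cons False ` ?S k. ?g (c # cs) P) + (\<Sum>P\<in>Cons True ` ?T. ?g (c # cs) P)"
    unfolding S using fin finT by (intro sum.union_disjoint) auto
  also have "\<dots> = (\<Sum>P\<in>?S k. ?g (c # cs) (False # P)) + (\<Sum>P\<in>?T. ?g (c # cs) (True # P))"
    by (simp only: sum.reindex[OF inj] comp_def)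
  also have "\<dots> = (\<Sum>P\<in>?S k. ?g cs P) + (\<Sum>P\<in>?T. f c * ?g cs P)"
    unfolding g by simp
  also have "\<dots> = elem_sym k f (set (c # cs))"
  proof (cases k)
    case 0
    have "distinct cs" using Cons.prems by simp
    from Cons.IH[OF this, of 0] show ?thesis by (simp add: 0)
  next
    case (Suc k')
    have "distinct cs" "c \<notin> set cs" using Cons.prems by simp_all
    then show ?thesis using Cons.IH[of k] Cons.IH[of k']
      by (simp add: Suc elem_sym_insert flip: sum_distrib_left)
  qed
  finally show ?case by simp
qed

section \<open>Crowding records\<close>

context matroid
begin

section \<open>Rank, nullity and crowd of subsets\<close>

lemma finite_indep: "indep X \<Longrightarrow> finite X"
  using indep_ground finite_ground finite_subset by blast

lemma finite_indep_subsets: "finite {X. X \<subseteq> S \<and> indep X}"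
  by (rule finite_subset[of _ "Pow E"]) (auto simp: finite_ground dest: indep_ground)

lemma card_le_rank: "X \<subseteq> S \<Longrightarrow> indep X \<Longrightarrow> card X \<le> rank S"
  unfolding rank_def using finite_indep_subsets by (intro Max_ge) auto

lemma rank_witness: obtains X where "X \<subseteq> S" "indep X" "card X = rank S"
proof -
  have "rank S \<in> card ` {X. X \<subseteq> S \<and> indep X}"
    unfolding rank_def using finite_indep_subsets[of S] indep_empty by (intro Max_in) auto
  then show ?thesis using that by auto
qed

lemma rank_mono: "S \<subseteq> T \<Longrightarrow> rank S \<le> rank T"
  by (metis card_le_rank order_trans rank_witness)

lemma rank_le_card: "finite S \<Longrightarrow> rank S \<le> card S"
  by (metis card_mono rank_witness)

lemma rank_empty [simp]: "rank {} = 0"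
  using rank_le_card[of "{}"] by simp

lemma indep_extend:
  assumes "indep X" "X \<subseteq> S"
  obtains Y where "X \<subseteq> Y" "Y \<subseteq> S" "indep Y" "card Y = rank S"
proof -
  let ?Q = "\<lambda>Y. X \<subseteq> Y \<and> Y \<subseteq> S \<and> indep Y"
  have "\<exists>Y. ?Q Y \<and> (\<forall>Y'. ?Q Y' \<longrightarrow> card Y' \<le> card Y)"
    using assms card_le_rank
    by (intro Lattices_Big.ex_has_greatest_nat[of ?Q X card "Suc (rank S)"]) (simp_all add: less_Suc_eq_le)
  then obtain Y where "?Q Y \<and> (\<forall>Y'. ?Q Y' \<longrightarrow> card Y' \<le> card Y)" ..
  then have Y: "?Q Y" and max: "?Q Y' \<Longrightarrow> card Y' \<le> card Y" for Y' by blast+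
  obtain Z where Z: "Z \<subseteq> S" "indep Z" "card Z = rank S" by (rule rank_witness)
  have "\<not> card Y < card Z"
  proof
    assume "card Y < card Z"
    then obtain e where e: "e \<in> Z - Y" "indep (insert e Y)"
      using indep_augment Y Z by blast
    then have "?Q (insert e Y)" using Y Z by auto
    from max[OF this] show False using e finite_indep Y by (simp add: card_insert_if)
  qed
  then have "card Y = rank S" using card_le_rank[of Y S] Y Z by simp
  then show ?thesis using that Y by blast
qed

lemma rank_submodular: "rank (S \<union> T) + rank (S \<inter> T) \<le> rank S + rank T"
proof -
  obtain X where X: "X \<subseteq> S \<inter> T" "indep X" "card X = rank (S \<inter> T)" by (rule rank_witness)
  then obtain Y where Y: "X \<subseteq> Y" "Y \<subseteq> S \<union> T" "indep Y" "card Y = rank (S \<union> T)"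
    using indep_extend[of X "S \<union> T"] by blast
  have "Y \<inter> S \<union> Y \<inter> T = Y" "(Y \<inter> S) \<inter> (Y \<inter> T) = Y \<inter> (S \<inter> T)" using Y by auto
  then have "card Y + card (Y \<inter> (S \<inter> T)) = card (Y \<inter> S) + card (Y \<inter> T)"
    using card_Un_Int[of "Y \<inter> S" "Y \<inter> T"] finite_indep Y by simp
  moreover have "card X \<le> card (Y \<inter> (S \<inter> T))"
    using X Y finite_indep by (intro card_mono) auto
  moreover have "card (Y \<inter> S) \<le> rank S" "card (Y \<inter> T) \<le> rank T"
    using indep_subset[OF Y(3)] by (auto intro: card_le_rank)
  ultimately show ?thesis using X Y by simp
qed

lemma rank_union_le: "rank (S \<union> T) \<le> rank S + rank T"
  using rank_submodular[of S T] by simp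

lemma rank_insert_le: "rank (insert e S) \<le> Suc (rank S)"
  using rank_union_le[of "{e}" S] rank_le_card[of "{e}"] by simp

lemma crowd_empty [simp]: "crowd {} = 0"
  by (simp add: crowd_def)

lemma crowd_supermodular:
  assumes "finite S" "finite T"
  shows "crowd S + crowd T \<le> crowd (S \<union> T) + crowd (S \<inter> T)"
  using rank_submodular[of S T] card_Un_Int[OF assms] by (simp add: crowd_def)

lemma nullity_mono:
  assumes "finite T" "S \<subseteq> T"
  shows "card S - rank S \<le> card T - rank T"
proof -
  have "rank T \<le> rank S + card (T - S)"
    using rank_union_le[of S "T - S"] rank_le_card[of "T - S"] assms by (simp add: Un_absorb1)
  moreover have "card T = card S + card (T - S)"
    using assms by (metis card_Diff_subset card_mono finite_subset le_add_diff_inverse)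
  ultimately show ?thesis by simp
qed

text \<open>With \<open>h m\<close> the height of a path after \<open>m\<close> steps, these are the
  sets whose lattice points the path is weakly above. A general \<open>h\<close> separates the
  Lipschitz property, on which the next lemmas rest, from the paths.\<close>

definition dominated_sets :: "(nat \<Rightarrow> nat) \<Rightarrow> 'a set set" where
  "dominated_sets h = {S. S \<subseteq> E \<and> rank S \<le> h (card S - rank S)}"

text \<open>Crowd is nullity minus rank. If the nullity drops by d from \<open>S\<close> to
  \<open>T\<close>, then \<open>h\<close> drops by at most d, while the rank drops by at least d
  because the crowd does not decrease.\<close>

lemma dominated_subset:
  assumes lip: "\<And>m n. n \<le> m \<Longrightarrow> h m \<le> h n + (m - n)"
    and "S \<in> dominated_sets h" "T \<subseteq> S" "crowd S \<le> crowd T"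
  shows "T \<in> dominated_sets h"
proof -
  have "S \<subseteq> E" using assms by (simp add: dominated_sets_def)
  then have fin: "finite S" "finite T" using assms(3) finite_ground by (meson finite_subset)+
  have "h (card S - rank S) \<le> h (card T - rank T) + ((card S - rank S) - (card T - rank T))"
    using fin assms by (intro lip nullity_mono)
  moreover have "rank S \<le> h (card S - rank S)" using assms(2) by (simp add: dominated_sets_def)
  moreover have "card S + 2 * rank T \<le> card T + 2 * rank S" using assms(4) by (simp add: crowd_def)
  ultimately have "rank T \<le> h (card T - rank T)"
    using rank_le_card[OF fin(1)] rank_le_card[OF fin(2)] nullity_mono[OF fin(1) assms(3)]
    by linarith
  then show ?thesis using assms \<open>S \<subseteq> E\<close> by (auto simp: dominated_sets_def)
qed

text \<open>
  For a nonrecord \<open>S\<close>, intersect with an overcrowded subset of maximal crowd that is as large as possible.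
\<close>

lemma mobius_nonrecord:
  assumes lip: "\<And>m n. n \<le> m \<Longrightarrow> h m \<le> h n + (m - n)" and "h 0 = 0"
    and S: "S \<in> dominated_sets h" "\<not> crowding_record S"
  shows "mobius (dominated_sets h) {} S = 0"
proof -
  have SE: "S \<subseteq> E" using S by (simp add: dominated_sets_def)
  have fin: "finite U" if "U \<subseteq> S" for U using that SE finite_ground by (meson finite_subset)
  define c where "c = Max (crowd ` Pow S)"
  have c_max: "crowd U \<le> c" if "U \<subseteq> S" for U
    unfolding c_def using that fin[of S] by (intro Max_ge) auto
  have "c \<in> crowd ` Pow S" unfolding c_def using fin[of S] by (intro Max_in) auto
  then obtain T\<^sub>1 where T1: "T\<^sub>1 \<subseteq> S" "crowd T\<^sub>1 = c" by auto
  obtain T\<^sub>0 where T0: "T\<^sub>0 \<subseteq> S" "overcrowded T\<^sub>0 S"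
    using S SE by (auto simp: crowding_record_def)
  let ?Q = "\<lambda>T. overcrowded T S \<and> crowd T = c"
  \<comment> \<open>If \<open>S\<close> has the maximal crowd \<open>c\<close>, so has any set
    overcrowded in it; otherwise any subset of crowd \<open>c\<close> is overcrowded.\<close>
  have "\<exists>T. ?Q T"
  proof (cases "c = crowd S")
    case True
    then show ?thesis using T0 c_max[of T\<^sub>0] by (intro exI[of _ T\<^sub>0]) (auto simp: overcrowded_def)
  next
    case False
    then have "crowd S < c" using c_max[of S] by simp
    then show ?thesis using T1 by (intro exI[of _ T\<^sub>1]) (auto simp: overcrowded_def)
  qed
  then obtain T\<^sub>2 where "?Q T\<^sub>2" ..
  moreover have "card T < Suc (card S)" if "?Q T" for T
    using that card_mono[OF fin[of S], of T] by (simp add: overcrowded_def less_Suc_eq_le)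
  ultimately have "\<exists>T. ?Q T \<and> (\<forall>T'. ?Q T' \<longrightarrow> card T' \<le> card T)"
    by (intro Lattices_Big.ex_has_greatest_nat[of ?Q T\<^sub>2 card "Suc (card S)"]) simp_all
  then obtain T where "?Q T \<and> (\<forall>T'. ?Q T' \<longrightarrow> card T' \<le> card T)" ..
  then have T: "overcrowded T S" "crowd T = c"
    and max: "overcrowded T' S \<Longrightarrow> crowd T' = c \<Longrightarrow> card T' \<le> card T" for T'
    by simp_all
  have TS: "T \<subseteq> S" using T by (simp add: overcrowded_def)
  have "T \<noteq> S" using T by (auto simp: overcrowded_def summand_def)
  show ?thesis
  proof (rule mobius_eq_0_if_Int_closed)
    show "finite S" using fin by simp
    show "\<not> S \<subseteq> T" using TS \<open>T \<noteq> S\<close> by auto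
    fix U assume U: "U \<in> dominated_sets h" "U \<subseteq> S" "U \<noteq> {}"
    have finUT: "finite U" "finite T" using U TS fin by auto
    have UT: "crowd (U \<union> T) \<le> c" using U TS by (intro c_max) auto
    have super: "crowd U + c \<le> crowd (U \<union> T) + crowd (U \<inter> T)"
      using crowd_supermodular[OF finUT] T by simp
    \<comment> \<open>Supermodularity and the maximality of \<open>c\<close> show that the crowd of
      \<open>U \<inter> T\<close> is at least that of \<open>U\<close>.\<close>
    have "U \<inter> T \<in> dominated_sets h"
      using super UT by (intro dominated_subset[OF lip U(1)]) auto
    moreover have "U \<inter> T \<noteq> {}"
    proof
      assume disj: "U \<inter> T = {}"
      \<comment> \<open>From \<open>h 0 = 0\<close> and the Lipschitz bound, dominated sets have
        rank at most nullity, hence nonnegative crowd. In the disjoint case this forces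
        \<open>U\<close> to have crowd zero and the ranks of \<open>U\<close> and \<open>T\<close>
        to add up.\<close>
      have "h (card U - rank U) \<le> card U - rank U" using lip[of 0] \<open>h 0 = 0\<close> by simp
      moreover have "rank U \<le> h (card U - rank U)" using U(1) by (simp add: dominated_sets_def)
      ultimately have "2 * rank U \<le> card U" using rank_le_card[OF finUT(1)] by linarith
      then have "0 \<le> crowd U" by (simp add: crowd_def)
      then have crowdU: "crowd U = 0" "crowd (U \<union> T) = c" using super UT disj by auto
      have cardUT: "card (U \<union> T) = card U + card T" using finUT disj by (simp add: card_Un_disjoint)
      then have rankUT: "rank (U \<union> T) = rank U + rank T"
        using crowdU T by (simp add: crowd_def)
      \<comment> \<open>This contradicts the choice of \<open>T\<close>, since
        \<open>U \<union> T\<close> is larger and still of crowd \<open>c\<close>.\<close>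
      have "overcrowded (U \<union> T) S"
      proof (cases "crowd S < c")
        case True
        then show ?thesis using crowdU U TS by (simp add: overcrowded_def)
      next
        case False
        then have notsum: "\<not> summand T S" "crowd S = c"
          using T by (auto simp: overcrowded_def)
        \<comment> \<open>Additivity of rank on \<open>U\<close> and \<open>T\<close> would turn a
          splitting of \<open>S\<close> at \<open>U \<union> T\<close> into one at
          \<open>T\<close>.\<close>
        have "\<not> summand (U \<union> T) S"
        proof
          assume "summand (U \<union> T) S"
          then have "rank S = rank U + rank T + rank (S - (U \<union> T))"
            using rankUT by (simp add: summand_def)
          moreover have "S - T = U \<union> (S - (U \<union> T))" using U disj by auto
          then have "rank (S - T) \<le> rank U + rank (S - (U \<union> T))"
            by (metis rank_union_le)
          moreover have "rank S \<le> rank T + rank (S - T)"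
            using rank_union_le[of T "S - T"] TS by (simp add: Un_absorb1)
          ultimately show False using notsum TS by (simp add: summand_def)
        qed
        then show ?thesis using crowdU notsum U TS by (simp add: overcrowded_def)
      qed
      from max[OF this crowdU(2)] show False
        using cardUT U(3) finUT by simp
    qed
    ultimately show "U \<inter> T \<in> dominated_sets h \<and> U \<inter> T \<noteq> {}" by simp
  qed (fact S)
qed

end

section \<open>Ferroni paths and omega\<close>

lemma count_list_take_le:
  "n \<le> m \<Longrightarrow> count_list (take m xs) x \<le> count_list (take n xs) x + (m - n)"
proof -
  assume "n \<le> m"
  then have "take m xs = take n xs @ take (m - n) (drop n xs)"
    by (metis le_add_diff_inverse take_add)
  moreover have "count_list (take (m - n) (drop n xs)) x \<le> m - n"
    by (rule order_trans[OF count_le_length]) simp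
  ultimately show ?thesis by simp
qed

lemma count_list_take_mono:
  "n \<le> m \<Longrightarrow> count_list (take n xs) x \<le> count_list (take m xs) x"
proof -
  assume "n \<le> m"
  then have "take m xs = take n xs @ take (m - n) (drop n xs)"
    by (metis le_add_diff_inverse take_add)
  then show ?thesis by simp
qed

lemma Collect_image_nat_Suc:
  fixes Q :: "nat \<Rightarrow> bool"
  shows "{f k | k. Q k} = (if Q 0 then {f 0} else {}) \<union> {f (Suc k) | k. Q (Suc k)}"
proof -
  have "(\<exists>k. x = f k \<and> Q k) \<longleftrightarrow> (x = f 0 \<and> Q 0) \<or> (\<exists>k. x = f (Suc k) \<and> Q (Suc k))" for x
    by (metis not0_implies_Suc)
  then show ?thesis by auto
qed

lemma inj_on_zvar: "finite E \<Longrightarrow> inj_on (zvar E) E"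
proof (rule inj_onI)
  fix e f assume E: "finite E" "e \<in> E" "f \<in> E" and "zvar E e = zvar E f"
  then have "Poly_Mapping.single (Poly_Mapping.single (to_nat_on E e) (1::nat)) (1::int) =
      Poly_Mapping.single (Poly_Mapping.single (to_nat_on E f) 1) 1"
    by (simp add: zvar_def eq_fract)
  then have "Poly_Mapping.single (to_nat_on E e) (1::nat) = Poly_Mapping.single (to_nat_on E f) 1"
    by (metis lookup_single_eq lookup_single_not_eq one_neq_zero)
  then have "to_nat_on E e = to_nat_on E f"
    by (metis lookup_single_eq lookup_single_not_eq one_neq_zero)
  then show "e = f" using E by (simp add: countable_finite)
qed

lemma coeff_minus_one_power_mult:
  "coeff ((-1) ^ m * p) k = (-1) ^ m * coeff p k" for p :: "'b::comm_ring_1 poly"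
  by (cases "even m") simp_all

lemma coeff_minus_X_power:
  "coeff ([:0, - 1:] ^ i) k = (if k = i then (-1) ^ i else 0 :: 'b::comm_ring_1)"
proof -
  have "[:0, - 1 :: 'b:] ^ i = monom ((-1) ^ i) i"
    by (induction i) (simp_all add: monom_Suc minus_monom)
  then show ?thesis by simp
qed

context matroid
begin

lemma weakly_above_lattice_point:
  "weakly_above P (lattice_point S) \<longleftrightarrow> rank S \<le> count_list (take (card S - rank S) P) True"
proof -
  have "take (min a (length P)) P = take a P" for a by (simp add: min_def)
  then show ?thesis by (simp add: weakly_above_def lattice_point_def)
qed

lemma finite_ferroni_paths: "finite ferroni_paths"
  by (rule finite_subset[OF _ finite_lists_length_eq[of UNIV "card E - rank E - 1"]])
    (auto simp: ferroni_paths_def)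

section \<open>Bases, coloops, loops, and the elements outside \<open>order_basis\<close>\<close>

lemma basis_card:
  assumes "basis B"
  shows "card B = rank E"
proof -
  have "indep B" "B \<subseteq> E" using assms indep_ground by (auto simp: basis_def)
  then obtain Y where "B \<subseteq> Y" "indep Y" "card Y = rank E" by (rule indep_extend)
  then show ?thesis using assms by (auto simp: basis_def)
qed

lemma basisI:
  assumes "indep B" "card B = rank E"
  shows "basis B"
  unfolding basis_def
proof (intro conjI allI impI assms)
  fix X assume X: "indep X" "B \<subseteq> X"
  then have "card X \<le> card B" using card_le_rank[of X E] indep_ground assms by simp
  then show "X = B" using X card_seteq finite_indep by blast
qed

lemma coloop_iff_rank: "coloop e \<longleftrightarrow> e \<in> E \<and> rank (E - {e}) < rank E"
proof (intro iffI conjI)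
  assume e: "coloop e"
  then show "e \<in> E" by (simp add: coloop_def)
  obtain X where X: "X \<subseteq> E - {e}" "indep X" "card X = rank (E - {e})" by (rule rank_witness)
  have "\<not> basis X" using e X by (auto simp: coloop_def)
  then have "rank (E - {e}) \<noteq> rank E" using X basisI by auto
  then show "rank (E - {e}) < rank E" using rank_mono[of "E - {e}" E] by simp
next
  assume e: "e \<in> E \<and> rank (E - {e}) < rank E"
  show "coloop e"
    unfolding coloop_def
  proof (intro conjI allI impI)
    fix B assume B: "basis B"
    show "e \<in> B"
    proof (rule ccontr)
      assume "e \<notin> B"
      then have "B \<subseteq> E - {e}" using B indep_ground by (auto simp: basis_def)
      then have "card B \<le> rank (E - {e})" using B by (intro card_le_rank) (auto simp: basis_def)
      then show False using basis_card[OF B] e by simp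
    qed
  qed (use e in simp)
qed

text \<open>Deleting a coloop lowers the cardinality by one and twice the rank by at least two, so
  the crowd grows.\<close>

lemma coloop_imp_not_record:
  assumes "coloop e"
  shows "\<not> crowding_record E"
proof -
  have e: "e \<in> E" "rank (E - {e}) < rank E" using assms by (auto simp: coloop_iff_rank)
  moreover have "0 < card E" using e finite_ground by (auto simp: card_gt_0_iff)
  ultimately have "crowd E < crowd (E - {e})"
    using finite_ground by (simp add: crowd_def card_Diff_singleton)
  then show ?thesis by (auto simp: crowding_record_def overcrowded_def)
qed

lemma rank_insert_loop:
  assumes "loop e"
  shows "rank (insert e S) = rank S"
proof -
  obtain X where X: "X \<subseteq> {e}" "indep X" "card X = rank {e}" by (rule rank_witness)
  have "X \<noteq> {e}" using X assms by (auto simp: loop_def)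
  then have "X = {}" using X by auto
  then have "rank {e} = 0" using X by simp
  then show ?thesis using rank_union_le[of "{e}" S] rank_mono[OF subset_insertI, of S e] by simp
qed

text \<open>For \<open>A\<close> empty, this lists the complement of \<open>order_basis\<close>. Its
  order matters: the i-th of these elements is paired with the i-th step of a path.\<close>

fun dependent_list :: "'a set \<Rightarrow> 'a list \<Rightarrow> 'a list" where
  "dependent_list A [] = []"
| "dependent_list A (a # w) =
     (if rank (insert a A) = rank A then [a] else []) @ dependent_list (insert a A) w"

lemma dependent_list_append:
  "dependent_list A (u @ v) = dependent_list A u @ dependent_list (A \<union> set u) v"
  by (induction u arbitrary: A) auto

lemma set_dependent_list:
  "set (dependent_list A w) =
    {w ! k | k. k < length w \<and> rank (A \<union> set (take (Suc k) w)) = rank (A \<union> set (take k w))}"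
proof (induction w arbitrary: A)
  case (Cons a w)
  show ?case
    by (subst Collect_image_nat_Suc) (simp add: Cons)
qed simp

lemma distinct_dependent_list: "distinct w \<Longrightarrow> distinct (dependent_list A w)"
proof (induction w arbitrary: A)
  case (Cons a w)
  have "set (dependent_list B w) \<subseteq> set w" for B by (auto simp: set_dependent_list)
  then show ?case using Cons by auto
qed simp

lemma length_dependent_list:
  "length (dependent_list A w) + rank (A \<union> set w) = rank A + length w"
proof (induction w arbitrary: A)
  case (Cons a w)
  have "rank (insert a A) = rank A \<or> rank (insert a A) = Suc (rank A)"
    using rank_insert_le[of a A] rank_mono[OF subset_insertI, of A a] by auto
  then show ?case using Cons[of "insert a A"] by auto
qed simp

lemma order_basis_compl:
  assumes "w \<in> permutations_of_set E"
  shows "E - order_basis w = set (dependent_list {} w)"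
proof -
  have E: "E = {w ! k | k. k < length w}" and d: "distinct w"
    using assms by (auto simp: permutations_of_set_def set_conv_nth)
  have le: "rank (set (take k w)) \<le> rank (set (take (Suc k) w))" for k
    by (intro rank_mono set_take_subset_set_take) simp
  show ?thesis
  proof (intro set_eqI iffI)
    fix x assume "x \<in> E - order_basis w"
    then obtain k where k: "k < length w" "x = w ! k" "x \<notin> order_basis w" using E by blast
    then have "\<not> rank (set (take k w)) < rank (set (take (Suc k) w))"
      unfolding order_basis_def by blast
    then have "rank (set (take (Suc k) w)) = rank (set (take k w))" using le[of k] by simp
    then show "x \<in> set (dependent_list {} w)" using k by (auto simp: set_dependent_list)
  next
    fix x assume "x \<in> set (dependent_list {} w)"
    then obtain k where k: "k < length w" "x = w ! k"
      "rank (set (take (Suc k) w)) = rank (set (take k w))"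
      by (auto simp: set_dependent_list)
    have "x \<notin> order_basis w"
    proof
      assume "x \<in> order_basis w"
      then obtain l where l: "l < length w" "x = w ! l"
        "rank (set (take l w)) < rank (set (take (Suc l) w))"
        by (auto simp: order_basis_def)
      then have "l = k" using d k by (simp add: nth_eq_iff_index_eq)
      then show False using k l by simp
    qed
    then show "x \<in> E - order_basis w" using E k by blast
  qed
qed

text \<open>The function \<delta> attached to the path. Past the end of the path \<open>take\<close>
  returns all of it, so for a Ferroni path the height of \<open>E\<close> is
  \<open>card E - 1\<close>, the top degree in \<open>flag_sum_eq_mobius\<close>.\<close>

definition path_height :: "bool list \<Rightarrow> 'a set \<Rightarrow> nat" where
  "path_height P S = (card S - rank S) + count_list (take (card S - rank S) P) True"

lemma path_height_mono:
  assumes "finite T" "S \<subseteq> T"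
  shows "path_height P S \<le> path_height P T"
  unfolding path_height_def
  by (intro add_mono nullity_mono count_list_take_mono assms)

text \<open>An element that raises the rank leaves the nullity unchanged and gets exponent 0. Any
  other element raises the nullity by one and gets exponent 2 or 1, according to whether the path
  has a diagonal step at that index. The indices start at the nullity of \<open>A\<close>.\<close>

lemma flag_monomial_path_height:
  assumes "finite A" "distinct w" "A \<inter> set w = {}"
  shows "flag_monomial z (path_height P) A w =
    (\<Prod>i<length (dependent_list A w). z (dependent_list A w ! i) *
       (if card A - rank A + i < length P \<and> P ! (card A - rank A + i)
        then z (dependent_list A w ! i) else 1))"
  using assms
proof (induction w arbitrary: A)
  case (Cons a w)
  have a: "a \<notin> A" and IHp: "finite (insert a A)" "distinct w" "insert a A \<inter> set w = {}"
    using Cons.prems by auto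
  have card: "card (insert a A) = Suc (card A)" using a Cons.prems by simp
  show ?case
  proof (cases "rank (insert a A) = rank A")
    case True
    let ?\<nu> = "card A - rank A"
    have \<nu>: "card (insert a A) - rank (insert a A) = Suc ?\<nu>"
      using True card rank_le_card[of A] Cons.prems by simp
    have "path_height P (insert a A) - path_height P A = (if ?\<nu> < length P \<and> P ! ?\<nu> then 2 else 1)"
      unfolding path_height_def \<nu>
      by (cases "?\<nu> < length P") (simp_all add: take_Suc_conv_app_nth)
    then have exp: "z a ^ (path_height P (insert a A) - path_height P A) =
        z a * (if ?\<nu> < length P \<and> P ! ?\<nu> then z a else 1)"
      by (simp add: power2_eq_square)
    show ?thesis
      unfolding flag_monomial.simps exp Cons.IH[OF IHp] \<nu> using True
      by (simp add: prod.lessThan_Suc_shift del: prod.lessThan_Suc cong: if_cong)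
  next
    case False
    then have "rank (insert a A) = Suc (rank A)"
      using rank_insert_le[of a A] rank_mono[OF subset_insertI, of A a] by auto
    then have \<nu>: "card (insert a A) - rank (insert a A) = card A - rank A" using card by simp
    then have "path_height P (insert a A) = path_height P A" by (simp add: path_height_def)
    then show ?thesis
      unfolding flag_monomial.simps Cons.IH[OF IHp] \<nu> using False by (simp cong: if_cong)
  qed
qed simp

lemma components_card_pos:
  assumes "E \<noteq> {}"
  shows "0 < card components"
proof -
  have "finite components"
    unfolding components_def quotient_def using finite_ground by simp
  moreover have "components \<noteq> {}" using assms by (auto simp: components_def quotient_def)
  ultimately show ?thesis by (simp add: card_gt_0_iff)
qed

text \<open>The extra diagonal step lets the path reach the point of \<open>E\<close>. It does not
  affect proper subsets: one whose nullity exceeds the length of \<open>P\<close> has rank below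
  that of \<open>E\<close>, and so already lies under \<open>P\<close>.\<close>

lemma dominated_sets_ferroni:
  assumes P: "P \<in> ferroni_paths" and U: "U \<subset> E"
  shows "U \<in> dominated_sets (\<lambda>a. count_list (take a (P @ [True])) True) \<longleftrightarrow>
    weakly_above P (lattice_point U)"
proof -
  have L: "length P + rank E + 1 = card E" "count_list P True + 1 = rank E"
    using P by (auto simp: ferroni_paths_def)
  have cU: "card U < card E" using U finite_ground by (intro psubset_card_mono)
  have null: "card U - rank U \<le> card E - rank E"
    using U finite_ground by (intro nullity_mono) auto
  show ?thesis
  proof (cases "card U - rank U \<le> length P")
    case True
    then show ?thesis using psubset_imp_subset[OF U]
      by (simp add: dominated_sets_def weakly_above_lattice_point)
  next
    case False
    then have "card U - rank U = Suc (length P)" using null L by simp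
    moreover have "rank U < rank E" using calculation cU L by linarith
    ultimately show ?thesis
      using U L by (simp add: dominated_sets_def weakly_above_lattice_point)
  qed
qed

text \<open>No Ferroni path is weakly above the point of \<open>E\<close>, hence the exception in
  the last assumption; the path extended by a diagonal step covers that case.\<close>

lemma mobius_ferroni_nonrecord:
  assumes P: "P \<in> ferroni_paths" and U: "U \<subseteq> E" "\<not> crowding_record U"
    and above: "U \<noteq> E \<Longrightarrow> weakly_above P (lattice_point U)"
  shows "mobius {S. weakly_above P (lattice_point S)} {} U = 0"
proof -
  let ?h = "\<lambda>a. count_list (take a (P @ [True])) True"
  have L: "length P + rank E + 1 = card E" "count_list P True + 1 = rank E"
    using P by (auto simp: ferroni_paths_def)
  have fin: "finite U" using U finite_ground finite_subset by blast
  have "mobius {S. weakly_above P (lattice_point S)} {} U = mobius (dominated_sets ?h) {} U"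
    using U by (intro mobius_cong fin) (use dominated_sets_ferroni[OF P] in blast)
  also have "\<dots> = 0"
  proof (rule mobius_nonrecord)
    show "U \<in> dominated_sets ?h"
    proof (cases "U = E")
      case True
      have "card E - rank E = Suc (length P)" using L by simp
      then show ?thesis using True L by (simp add: dominated_sets_def)
    next
      case False
      then show ?thesis using above U dominated_sets_ferroni[OF P, of U] by blast
    qed
    show "?h m \<le> ?h n + (m - n)" if "n \<le> m" for m n
      using that by (rule count_list_take_le)
  qed (use U in auto)
  finally show ?thesis .
qed

lemma mobius_ferroni_loop:
  assumes P: "P \<in> ferroni_paths" and e: "loop e"
  shows "mobius {S. weakly_above P (lattice_point S)} {} E = 0"
proof (rule mobius_eq_0_if_insert_closed[of _ e])
  have L: "length P + rank E + 1 = card E" "count_list P True + 1 = rank E"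
    using P by (auto simp: ferroni_paths_def)
  show eE: "e \<in> E" using e by (simp add: loop_def)
  have rank_e: "rank {e} = 0" using rank_insert_loop[OF e, of "{}"] by simp
  then show "{e} \<in> {S. weakly_above P (lattice_point S)}"
    by (simp add: weakly_above_lattice_point)
  show "E \<noteq> {e}" using rank_e L by auto
  have "rank (E - {e}) = rank E" using rank_insert_loop[OF e, of "E - {e}"] eE by (simp add: insert_absorb)
  \<comment> \<open>Its nullity is the length of \<open>P\<close>, but its rank is that of
    \<open>E\<close>, one more than the number of diagonal steps.\<close>
  then show "E - {e} \<notin> {S. weakly_above P (lattice_point S)}"
    using L eE finite_ground by (simp add: weakly_above_lattice_point card_Diff_singleton)
  show "insert e U \<in> {S. weakly_above P (lattice_point S)}"
    if "U \<in> {S. weakly_above P (lattice_point S)}" "U \<subseteq> E" for U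
  proof -
    have "finite U" using that finite_ground finite_subset by blast
    then have "card U - rank U \<le> card (insert e U) - rank U"
      by (intro diff_le_mono card_insert_le)
    then have "count_list (take (card U - rank U) P) True \<le>
        count_list (take (card (insert e U) - rank U) P) True"
      by (rule count_list_take_mono)
    then show ?thesis
      using that by (simp add: weakly_above_lattice_point rank_insert_loop[OF e])
  qed
qed (fact finite_ground)

text \<open>Translates conditions on the indices 1 to k-1 into conditions on the interior of a
  chain. The ends are records: \<open>E\<close> by assumption, and the empty set always.\<close>

lemma record_chains_above:
  assumes "E \<noteq> {}" "crowding_record E"
  shows "{Ss \<in> record_chains. \<forall>i\<in>{1..length Ss - 1 - 1}. Q (Ss ! i)} =
    set_chains ({S. Q S} \<inter> {S. crowding_record S}) {} E"
proof -
  have inner: "set (butlast (tl Ss)) = (!) Ss ` {1..length Ss - 1 - 1}" for Ss :: "'a set list"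
  proof -
    have "set (butlast (tl Ss)) = {butlast (tl Ss) ! j | j. j < length Ss - 1 - 1}"
      by (simp add: set_conv_nth)
    also have "\<dots> = (\<lambda>j. Ss ! Suc j) ` {..<length Ss - 1 - 1}"
      by (force simp: nth_butlast nth_tl)
    also have "\<dots> = (!) Ss ` Suc ` {..<length Ss - 1 - 1}" by (simp add: image_image)
    also have "Suc ` {..<length Ss - 1 - 1} = {1..length Ss - 1 - 1}"
      by (simp add: image_Suc_lessThan)
    finally show ?thesis .
  qed
  have empty_record: "crowding_record {}"
    by (auto simp: crowding_record_def overcrowded_def summand_def)
  have set_eq: "set Ss = insert (hd Ss) (insert (last Ss) (set (butlast (tl Ss))))"
    if len: "2 \<le> length Ss" for Ss :: "'a set list"
  proof -
    obtain S Ss' where Ss: "Ss = S # Ss'"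
      using len by (cases Ss) auto
    then have "Ss' \<noteq> []" using len by auto
    then have "Ss' = butlast Ss' @ [last Ss']" by simp
    then have "set Ss' = insert (last Ss') (set (butlast Ss'))"
      by (metis Un_insert_right empty_set list.simps(15) set_append sup_bot_right)
    then show ?thesis using Ss \<open>Ss' \<noteq> []\<close> by simp
  qed
  have len: "2 \<le> length Ss" if "Ss \<in> set_chains X {} E" for Ss X
  proof (rule ccontr)
    assume "\<not> 2 \<le> length Ss"
    moreover have "0 < length Ss" using that by (simp add: set_chains_def)
    ultimately have "length Ss = 1" by linarith
    then have "hd Ss = last Ss" by (cases Ss) auto
    then show False using that assms by (auto simp: set_chains_def)
  qed
  show ?thesis
  proof (intro set_eqI iffI)
    fix Ss assume "Ss \<in> {Ss \<in> record_chains. \<forall>i\<in>{1..length Ss - 1 - 1}. Q (Ss ! i)}"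
    then have "2 \<le> length Ss" "hd Ss = {}" "last Ss = E" "sorted_wrt (\<subset>) Ss"
      "\<forall>S\<in>set Ss. crowding_record S" "\<forall>i\<in>{1..length Ss - 1 - 1}. Q (Ss ! i)"
      by (simp_all add: record_chains_def)
    moreover from this have "set (butlast (tl Ss)) \<subseteq> {S. Q S} \<inter> {S. crowding_record S}"
      using set_eq[of Ss] inner[of Ss] by auto
    ultimately show "Ss \<in> set_chains ({S. Q S} \<inter> {S. crowding_record S}) {} E"
      by (auto simp: set_chains_def)
  next
    fix Ss assume Ss: "Ss \<in> set_chains ({S. Q S} \<inter> {S. crowding_record S}) {} E"
    from len[OF this] have "2 \<le> length Ss" .
    moreover have "hd Ss = {}" "last Ss = E" "sorted_wrt (\<subset>) Ss"
      "set (butlast (tl Ss)) \<subseteq> {S. Q S} \<inter> {S. crowding_record S}"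
      using Ss by (simp_all add: set_chains_def)
    moreover from this have "\<forall>S\<in>set Ss. crowding_record S"
      using set_eq[OF \<open>2 \<le> length Ss\<close>] assms(2) empty_record by auto
    ultimately show "Ss \<in> {Ss \<in> record_chains. \<forall>i\<in>{1..length Ss - 1 - 1}. Q (Ss ! i)}"
      using inner[of Ss] by (auto simp: record_chains_def)
  qed
qed

text \<open>After exchanging the two sums, Hall's theorem gives a Moebius number over records for
  each path, and nonrecords may be added since their numbers vanish. The global minus sign comes
  from k-1 in place of k. If \<open>E\<close> is not a record, both sides are zero.\<close>

lemma sum_record_chains:
  assumes "E \<noteq> {}"
  shows "(\<Sum>Ss\<in>record_chains. let k = length Ss - 1 in (-1) ^ (k - 1) *
      int (card {P \<in> ferroni_paths. \<forall>i\<in>{1..k - 1}. weakly_above P (lattice_point (Ss ! i))})) =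
    - (\<Sum>P\<in>ferroni_paths. mobius {S. weakly_above P (lattice_point S)} {} E)"
proof (cases "crowding_record E")
  case False
  have "Ss \<notin> record_chains" for Ss
  proof
    assume "Ss \<in> record_chains"
    then have "Ss \<noteq> []" "last Ss = E" "\<forall>S\<in>set Ss. crowding_record S"
      by (auto simp: record_chains_def)
    then show False using False last_in_set by metis
  qed
  then have "record_chains = {}" by blast
  moreover have "mobius {S. weakly_above P (lattice_point S)} {} E = 0" if "P \<in> ferroni_paths" for P
    using that False by (intro mobius_ferroni_nonrecord) auto
  ultimately show ?thesis by simp
next
  case True
  let ?Q = "\<lambda>P Ss. \<forall>i\<in>{1..length Ss - 1 - 1}. weakly_above P (lattice_point (Ss ! i))"
  let ?s = "\<lambda>Ss. (-1) ^ (length Ss - 1 - 1) :: int"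
  have "(\<Sum>Ss\<in>record_chains. let k = length Ss - 1 in (-1) ^ (k - 1) *
      int (card {P \<in> ferroni_paths. \<forall>i\<in>{1..k - 1}. weakly_above P (lattice_point (Ss ! i))})) =
      (\<Sum>Ss\<in>record_chains. \<Sum>P\<in>ferroni_paths. if ?Q P Ss then ?s Ss else 0)"
    using finite_ferroni_paths
    by (simp add: Let_def mult.commute flip: sum.inter_filter)
  also have "\<dots> = (\<Sum>P\<in>ferroni_paths. \<Sum>Ss\<in>record_chains. if ?Q P Ss then ?s Ss else 0)"
    by (rule sum.swap)
  also have "\<dots> = (\<Sum>P\<in>ferroni_paths. - mobius {S. weakly_above P (lattice_point S)} {} E)"
  proof (rule sum.cong)
    fix P assume P: "P \<in> ferroni_paths"
    let ?W = "{S. weakly_above P (lattice_point S)}"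
    let ?C = "{Ss \<in> record_chains. ?Q P Ss}"
    have "(\<Sum>Ss\<in>record_chains. if ?Q P Ss then ?s Ss else 0) = (\<Sum>Ss\<in>?C. ?s Ss)"
      using finite_record_chains by (simp only: sum.inter_filter)
    also have "\<dots> = (\<Sum>Ss\<in>?C. - ((-1) ^ (length Ss - 1)))"
    proof (rule sum.cong)
      fix Ss assume "Ss \<in> ?C"
      then have "2 \<le> length Ss" by (simp add: record_chains_def)
      then have "length Ss - 1 = Suc (length Ss - 1 - 1)" by simp
      then show "?s Ss = - ((-1) ^ (length Ss - 1))"
        by (metis mult_minus1 minus_minus power_Suc)
    qed simp
    also have "\<dots> = - mobius (?W \<inter> {S. crowding_record S}) {} E"
      using record_chains_above[OF assms True, of "\<lambda>S. weakly_above P (lattice_point S)"]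
        sum_set_chains[OF finite_ground, of "{}" "?W \<inter> {S. crowding_record S}"]
      by (simp add: sum_negf)
    also have "mobius (?W \<inter> {S. crowding_record S}) {} E = mobius ?W {} E"
    proof (rule mobius_Int[symmetric])
      fix U assume "U \<subset> E" "U \<in> ?W" "U \<notin> {S. crowding_record S}"
      then show "mobius ?W {} U = 0" by (intro mobius_ferroni_nonrecord P) auto
    qed (fact finite_ground)
    finally show "(\<Sum>Ss\<in>record_chains. if ?Q P Ss then ?s Ss else 0) = - mobius ?W {} E" .
  qed simp
  finally show ?thesis by (simp add: sum_negf)
qed

text \<open>For i = r the factor in \<open>xvar\<close> is 1, and the factor in \<open>yvar\<close>
  is a full product. The last element is no coloop, so it lies outside \<open>order_basis\<close>,
  and the sum over j divides its variable out of the elementary symmetric polynomial.\<close>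

lemma elem_sym_sum_eq_flag_monomials:
  assumes w: "w \<in> permutations_of_set E" and "E \<noteq> {}" and nl: "\<And>e. \<not> loop e" "\<And>e. \<not> coloop e"
  shows "(\<Sum>j<rank E. alpha w ^ j * elem_sym (rank E - j - 1) (\<lambda>c. - yvar c) (E - order_basis w)
        * elem_sym (rank E - rank E) xvar (order_basis w)
        * elem_sym (card E - rank E) yvar (E - order_basis w)) =
      (-1) ^ (card E - rank E) * (\<Sum>P\<in>ferroni_paths. flag_monomial (zvar E) (path_height P) {} w)"
proof -
  let ?z = "zvar E"
  have sw: "set w = E" "distinct w" using w by (auto simp: permutations_of_set_def)
  then have lw: "length w = card E" using distinct_card by fastforce
  obtain v l where vl: "w = v @ [l]" using sw \<open>E \<noteq> {}\<close> by (metis append_butlast_last_id empty_set)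
  have l: "l \<in> E" "set v = E - {l}" using sw vl by auto
  have "\<not> rank (E - {l}) < rank E" using nl(2)[of l] l by (simp add: coloop_iff_rank)
  then have rl: "rank (E - {l}) = rank E" using rank_mono[of "E - {l}" E] by simp
  define us where "us = dependent_list {} v"
  have cs: "dependent_list {} w = us @ [l]"
    using rl l by (simp add: vl dependent_list_append us_def insert_absorb)
  have dus: "distinct us" "l \<notin> set us"
    using distinct_dependent_list[OF sw(2), of "{}"] unfolding cs by auto
  have N: "E - order_basis w = insert l (set us)"
    using order_basis_compl[OF w] cs by simp
  have len: "Suc (length us) + rank E = card E"
    using length_dependent_list[of "{}" w] cs sw lw by simp
  have "rank E \<noteq> 0"
  proof
    assume "rank E = 0"
    then have "\<not> indep {l}" using card_le_rank[of "{l}" E] l by auto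
    then show False using nl(1)[of l] l by (simp add: loop_def)
  qed
  then obtain k where k: "rank E = Suc k" using not0_implies_Suc by blast
  have cardN: "card E - rank E = card (insert l (set us))"
    using dus len by (simp add: distinct_card)
  have "elem_sym (card E - rank E) yvar (E - order_basis w) = (\<Prod>c\<in>insert l (set us). - ?z c)"
    unfolding cardN N by (subst elem_sym_card) (auto simp: yvar_def)
  also have "\<dots> = (-1) ^ (card E - rank E) * (?z l * (\<Prod>c\<in>set us. ?z c))"
    using dus cardN by (simp add: prod_uminus)
  finally have y: "elem_sym (card E - rank E) yvar (E - order_basis w) =
      (-1) ^ (card E - rank E) * (?z l * (\<Prod>c\<in>set us. ?z c))" .
  have finB: "finite (order_basis w)" by (simp add: order_basis_def)
  have "(\<Sum>j<rank E. alpha w ^ j * elem_sym (rank E - j - 1) (\<lambda>c. - yvar c) (E - order_basis w)) =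
      (\<Sum>j<Suc k. (- ?z l) ^ j * elem_sym (k - j) ?z (insert l (set us)))"
    unfolding N k by (intro sum.cong) (auto simp: alpha_def vl yvar_def)
  also have "\<dots> = elem_sym k ?z (set us)"
    using dus by (intro sum_elem_sym_insert) auto
  also have "\<dots> = (\<Sum>P | length P = length us \<and> count_list P True = k.
      \<Prod>i<length us. if P ! i then ?z (us ! i) else 1)"
    using dus by (intro elem_sym_list)
  \<comment> \<open>Removing \<open>l\<close> leaves n-r-1 elements, of which r-1 are chosen:
    exactly the step counts of a Ferroni path.\<close>
  also have "{P. length P = length us \<and> count_list P True = k} = ferroni_paths"
    using len k by (auto simp: ferroni_paths_def)
  finally have sum: "(\<Sum>j<rank E. alpha w ^ j * elem_sym (rank E - j - 1) (\<lambda>c. - yvar c) (E - order_basis w)) =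
      (\<Sum>P\<in>ferroni_paths. \<Prod>i<length us. if P ! i then ?z (us ! i) else 1)" .
  have mono: "flag_monomial ?z (path_height P) {} w =
      (\<Prod>i<length us. if P ! i then ?z (us ! i) else 1) * (?z l * (\<Prod>c\<in>set us. ?z c))"
    if P: "P \<in> ferroni_paths" for P
  proof -
    have lP: "length P = length us" using P len by (simp add: ferroni_paths_def)
    have "flag_monomial ?z (path_height P) {} w = (\<Prod>i<length (us @ [l]). ?z ((us @ [l]) ! i) *
       (if i < length P \<and> P ! i then ?z ((us @ [l]) ! i) else 1))"
      using flag_monomial_path_height[of "{}" w ?z P] sw unfolding cs by simp
    \<comment> \<open>The index of \<open>l\<close> equals \<open>length P\<close>, past the last
      step, so \<open>l\<close> has exponent 1.\<close>
    also have "\<dots> = (\<Prod>i<length us. ?z (us ! i) * (if P ! i then ?z (us ! i) else 1)) * ?z l"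
      by (simp add: lP nth_append cong: if_cong)
    also have "(\<Prod>i<length us. ?z (us ! i) * (if P ! i then ?z (us ! i) else 1)) =
        (\<Prod>i<length us. ?z (us ! i)) * (\<Prod>i<length us. if P ! i then ?z (us ! i) else 1)"
      by (rule prod.distrib)
    also have "(\<Prod>i<length us. ?z (us ! i)) = (\<Prod>c\<in>set us. ?z c)"
      using dus by (intro prod.reindex_bij_betw bij_betw_nth) auto
    finally show ?thesis by (simp add: ac_simps)
  qed
  have "(\<Sum>j<rank E. alpha w ^ j * elem_sym (rank E - j - 1) (\<lambda>c. - yvar c) (E - order_basis w)
        * elem_sym (rank E - rank E) xvar (order_basis w)
        * elem_sym (card E - rank E) yvar (E - order_basis w)) =
      (\<Sum>P\<in>ferroni_paths. \<Prod>i<length us. if P ! i then ?z (us ! i) else 1) *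
      elem_sym (card E - rank E) yvar (E - order_basis w)"
    using finB unfolding diff_self_eq_0 elem_sym_0[OF finB] mult_1_right
    by (simp only: sum sum_distrib_right[symmetric])
  also have "\<dots> = (-1) ^ (card E - rank E) *
      (\<Sum>P\<in>ferroni_paths. flag_monomial ?z (path_height P) {} w)"
    by (simp add: y mono sum_distrib_right sum_distrib_left mult_ac)
  finally show ?thesis .
qed

text \<open>The height of \<open>E\<close> is exactly the top degree. Cancelling the nullity in |C|
  <= \<delta>(C) leaves the condition that the path is weakly above the point of C.\<close>

lemma flag_sum_path_height:
  assumes "E \<noteq> {}" and P: "P \<in> ferroni_paths"
  shows "flag_sum (zvar E) (path_height P) {} E =
    (-1) ^ card E * of_int (mobius {S. weakly_above P (lattice_point S)} {} E)"
proof -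
  have L: "length P + rank E + 1 = card E" "count_list P True + 1 = rank E"
    using P by (auto simp: ferroni_paths_def)
  then have top: "Suc (path_height P E) = card E" by (simp add: path_height_def)
  have bot: "path_height P {} = 0" by (simp add: path_height_def)
  have "flag_sum (zvar E) (path_height P) {} E =
    (-1) ^ card E * of_int (mobius (heavy_sets (path_height P) {}) {} E)"
    using top bot assms
    by (subst flag_sum_eq_mobius)
      (auto simp: finite_ground inj_on_zvar intro: path_height_mono finite_subset[OF _ finite_ground])
  also have "mobius (heavy_sets (path_height P) {}) {} E =
      mobius {S. weakly_above P (lattice_point S)} {} E"
  proof (rule mobius_cong[OF finite_ground])
    fix C assume "C \<subset> E"
    then have "finite C" using finite_ground finite_subset by blast
    then have "rank C \<le> card C" by (rule rank_le_card)
    then show "C \<in> heavy_sets (path_height P) {} \<longleftrightarrow> C \<in> {S. weakly_above P (lattice_point S)}"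
      using bot by (auto simp: heavy_sets_def path_height_def weakly_above_lattice_point)
  qed
  finally show ?thesis .
qed

text \<open>Only i = r contributes to the coefficient of t^r. Exchanging the sums over orderings and
  paths then leaves one flag sum per path.\<close>

lemma omega_circ_eq_mobius:
  assumes "E \<noteq> {}" and nl: "\<And>e. \<not> loop e" "\<And>e. \<not> coloop e"
  shows "omega_circ =
    of_int (- (\<Sum>P\<in>ferroni_paths. mobius {S. weakly_above P (lattice_point S)} {} E))"
proof -
  let ?r = "rank E" and ?n = "card E"
  let ?f = "\<lambda>i j w. alpha w ^ j * elem_sym (i - j - 1) (\<lambda>c. - yvar c) (E - order_basis w)
      * elem_sym (?r - i) xvar (order_basis w) * elem_sym (?n - ?r) yvar (E - order_basis w)"
  have rn: "?r \<le> ?n" by (rule rank_le_card[OF finite_ground])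
  have "rank E \<noteq> 0"
  proof
    assume r: "rank E = 0"
    obtain l where l: "l \<in> E" using assms(1) by auto
    then have "\<not> indep {l}" using card_le_rank[of "{l}" E] r by auto
    then show False using nl(1)[of l] l by (simp add: loop_def)
  qed
  have "omega = (-1) ^ card components * (\<Sum>i=1..?r. (\<Sum>j<i. deg (?f i j)) * (if ?r = i then (-1) ^ i else 0))"
    using assms by (simp add: omega_def g_poly_def coeff_minus_one_power_mult coeff_sum coeff_minus_X_power)
  also have "(\<Sum>i=1..?r. (\<Sum>j<i. deg (?f i j)) * (if ?r = i then (-1) ^ i else 0)) =
      (\<Sum>j<?r. deg (?f ?r j)) * (-1) ^ ?r"
    using \<open>rank E \<noteq> 0\<close> by (simp add: if_distrib[of "(*) _"] sum.delta cong: if_cong)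
  also have "(\<Sum>j<?r. deg (?f ?r j)) =
      (\<Sum>w\<in>permutations_of_set E. (\<Sum>j<?r. ?f ?r j w) * path_weight (zvar E) w)"
    unfolding deg_def
    by (subst sum.swap, intro sum.cong refl)
      (simp add: path_weight_eq_prod length_finite_permutations_of_set sum_divide_distrib)
  also have "\<dots> = (\<Sum>w\<in>permutations_of_set E. (-1) ^ (?n - ?r) *
      (\<Sum>P\<in>ferroni_paths. flag_monomial (zvar E) (path_height P) {} w * path_weight (zvar E) w))"
  proof (rule sum.cong)
    fix w assume "w \<in> permutations_of_set E"
    note elem_sym_sum_eq_flag_monomials[OF this assms(1) nl]
    then show "(\<Sum>j<?r. ?f ?r j w) * path_weight (zvar E) w = (-1) ^ (?n - ?r) *
        (\<Sum>P\<in>ferroni_paths. flag_monomial (zvar E) (path_height P) {} w * path_weight (zvar E) w)"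
      by (simp only: mult.assoc sum_distrib_right[symmetric])
  qed simp
  also have "\<dots> = (-1) ^ (?n - ?r) * (\<Sum>P\<in>ferroni_paths. flag_sum (zvar E) (path_height P) {} E)"
    by (subst sum_distrib_left[symmetric], subst sum.swap) (simp add: flag_sum_def)
  also have "(\<Sum>P\<in>ferroni_paths. flag_sum (zvar E) (path_height P) {} E) =
      (-1) ^ ?n * of_int (\<Sum>P\<in>ferroni_paths. mobius {S. weakly_above P (lattice_point S)} {} E)"
    using assms by (simp add: flag_sum_path_height sum_distrib_left)
  finally have "omega_circ = (-1) ^ (card components - 1) * (-1) ^ card components *
      ((-1) ^ (?n - ?r) * (-1) ^ ?n * (-1) ^ ?r) *
      of_int (\<Sum>P\<in>ferroni_paths. mobius {S. weakly_above P (lattice_point S)} {} E)"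
    by (simp add: omega_circ_def)
  \<comment> \<open>The component signs leave -1, there being at least one component. The signs from
    \<open>yvar\<close>, the flag sums and the power of -t cancel.\<close>
  moreover have "(-1 :: zfrac) ^ (card components - 1) * (-1) ^ card components = -1"
    using components_card_pos[OF assms(1)] by (cases "card components") auto
  moreover have "(-1 :: zfrac) ^ (?n - ?r) * (-1) ^ ?n * (-1) ^ ?r = 1"
    using rn by (simp add: mult.commute mult.left_commute flip: power_add power_mult_distrib)
  ultimately show ?thesis by simp
qed

end

theorem proposition10p12:
  fixes E :: "'a set" and indep :: "'a set \<Rightarrow> bool"
  assumes "matroid E indep"
    and "E \<noteq> {}"
  shows "matroid.omega_circ E indep =
    of_int (\<Sum>Ss\<in>matroid.record_chains E indep.
      let k = length Ss - 1 in
        (-1) ^ (k - 1) *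
        int (card {P \<in> matroid.ferroni_paths E indep.
          \<forall>i\<in>{1..k - 1}. weakly_above P (matroid.lattice_point indep (Ss ! i))}))"
proof -
  interpret matroid E indep by (fact assms)
  show ?thesis
  proof (cases "\<exists>e. loop e \<or> coloop e")
    case True
    then have "omega_circ = 0" using assms by (simp add: omega_circ_def omega_def g_poly_def)
    \<comment> \<open>Here \<open>omega\<close> is zero by definition, so the Moebius side has to
      vanish too: a coloop prevents \<open>E\<close> from being a record, and a loop contracts the
      poset directly.\<close>
    moreover have "(\<Sum>P\<in>ferroni_paths. mobius {S. weakly_above P (lattice_point S)} {} E) = 0"
    proof (intro sum.neutral ballI)
      fix P assume P: "P \<in> ferroni_paths"
      from True show "mobius {S. weakly_above P (lattice_point S)} {} E = 0"
        using mobius_ferroni_loop[OF P] mobius_ferroni_nonrecord[OF P order_refl]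
          coloop_imp_not_record by blast
    qed
    ultimately show ?thesis by (simp only: sum_record_chains[OF assms(2)]) simp
  next
    case False
    then have "\<not> loop e" "\<not> coloop e" for e by auto
    from omega_circ_eq_mobius[OF assms(2) this] show ?thesis
      by (simp only: sum_record_chains[OF assms(2)])
  qed
qed

end
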